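(* Let $\tau$ be a composition of $n$. The $\mathcal H$-module $\mathcal H(\mathcal V_\tau)$, given by $[i]\mapsto\mathcal V_{\tau+(1^{i-n})}$ for $i\ge n$ and $[i]\mapsto0$ for $i<n$, with $\iota_{i,i+1}$ acting by $\Phi_i$ for $i\ge n$, is finitely generated.
   Context: Fix a field $\mathbf k$. For $n\ge 0$ let $[n]=\{1,\dots,n\}$, and let $H_n(0)$ be the unital associative $\mathbf k$-algebra generated by $\pi_1,\dots,\pi_{n-1}$ with relations $\pi_i^2=\pi_i$, $\pi_i\pi_{i+1}\pi_i=\pi_{i+1}\pi_i\pi_{i+1}$, and $\pi_i\pi_j=\pi_j\pi_i$ for $|i-j|>1$. For $w\in\mathfrak S_n$ with reduced expression $w=s_{i_1}\cdots s_{i_r}$ in the adjacent transpositions $s_i=(i,i+1)$, put $\pi_w=\pi_{i_1}\cdots\pi_{i_r}$; the $\pi_w$ form a basis of $H_n(0)$ and a monoid $\mathcal M_n$ under multiplication. For $n\le m$, $\mathcal M_n\subseteq\mathcal M_m$ via $\pi_i\mapsto\pi_i$. The $0$-Hecke category $\mathcal H$ has objects $[n]$, $n\ge0$. For $n\le m$, $\mathrm{Hom}_{\mathcal H}([n],[m])$ is the set of braid diagrams from $n$ top vertices to $m$ bottom vertices with only positive crossings, modulo $\pi_i^2=\pi_i$, composed by padding with dummy strands, multiplying in the $0$-Hecke monoid and deleting dummy strands; there are no morphisms if $n>m$. Algebraically, $\mathrm{Hom}_{\mathcal H}([n],[m])$ is the quotient of $\mathcal M_m$ by the equivalence relation generated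 by $x\sim x\pi_j$ for $n+1\le j\le m-1$, and the composite of the class of $y\in\mathcal M_\ell$ in $\mathrm{Hom}([m],[\ell])$ with the class of $x\in\mathcal M_m$ in $\mathrm{Hom}([n],[m])$ is the class of $yx\in\mathcal M_\ell$. The principal injection $\iota_{n,m}$ is the class of $1$. An $\mathcal H$-module is a functor $V$ from $\mathcal H$ to $\mathbf k$-vector spaces; $V_n=V([n])$ is an $H_n(0)$-module since $\mathrm{End}_{\mathcal H}([n])=\mathcal M_n$. It is finitely generated if finitely many elements are contained in no proper submodule. A composition $\alpha=(\alpha_1,\dots,\alpha_r)$ of $n$ is a sequence of positive integers with sum $n$; $\alpha+(1^d)$ denotes $\alpha$ followed by $d$ entries equal to $1$. The reverse composition diagram of $\alpha$ has left-justified rows with $\alpha_i$ boxes in row $i$ from the top; box $(i,j)$ is in row $i$, column $j$. A standard reverse composition tableau (SRCT) of shape $\alpha$ is a bijective filling $T$ of the boxes by $1,\dots,n$ such that: (1) entries in each row decrease from left to right; (2) entries in the first column increase from top to bottom; (3) if $i<j$ and $T(i,k)>T(j,k+1)$, then $T(i,k+1)$ exists and $T(i,k+1)>T(j,k+1)$. $\mathrm{SRCT}(\alpha)$ is the set of these. $\mathrm{Des}(T)=\{i\in[n-1]\mid i+1\text{ appears weakly right of }i\text{ in }T\}$. The entries $i,i+1$ are attacking in $T$ if they are in the same column, or they are in adjacent columns with $i+1$ strictly below and to the right of $i$. $\mathcal V_\alpha$ is the $\mathbf k$-vector space with basis $\mathrm{SRCT}(\alpha)$, with $H_n(0)$-action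 $\pi_i(T)=0$ if $i\notin\mathrm{Des}(T)$; $\pi_i(T)=T$ if $i\in\mathrm{Des}(T)$ and $i,i+1$ are attacking; $\pi_i(T)=s_i(T)+T$ if $i\in\mathrm{Des}(T)$ and $i,i+1$ are non-attacking, where $s_i(T)$ interchanges the entries $i$ and $i+1$. For a composition $\alpha$ of $i$, the map $\Phi_i:\mathcal V_\alpha\to\mathcal V_{\alpha+(1)}$ sends $T\in\mathrm{SRCT}(\alpha)$ to the SRCT of shape $\alpha+(1)$ obtained by filling the boxes of $\alpha$ as in $T$ and placing $i+1$ in the new box. *)

theory Defs
  imports Complex_Main "HOL-Library.Poly_Mapping" "HOL-Combinatorics.Transposition"
begin

section \<open>The 0-Hecke monoid\<close>

text \<open>
  A word \<open>[i\<^sub>1, \<dots>, i\<^sub>r]\<close> stands for the product of the generators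
  with these indices, in this order.
\<close>

definition words :: "nat \<Rightarrow> nat list set" where
  "words n = lists {1..<n}"

definition hecke_relations :: "nat \<Rightarrow> (nat list \<times> nat list) set" where
  "hecke_relations n =
     {([i, i], [i]) | i. i \<in> {1..<n}}
   \<union> {([i, Suc i, i], [Suc i, i, Suc i]) | i. i \<in> {1..<n} \<and> Suc i \<in> {1..<n}}
   \<union> {([i, j], [j, i]) | i j. i \<in> {1..<n} \<and> j \<in> {1..<n} \<and> \<bar>int i - int j\<bar> > 1}"

inductive hecke_eq :: "nat \<Rightarrow> nat list \<Rightarrow> nat list \<Rightarrow> bool" for n where
  rel: "(a, b) \<in> hecke_relations n \<Longrightarrow> u \<in> words n \<Longrightarrow> v \<in> words n \<Longrightarrow>
          hecke_eq n (u @ a @ v) (u @ b @ v)"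
| refl: "u \<in> words n \<Longrightarrow> hecke_eq n u u"
| sym: "hecke_eq n u v \<Longrightarrow> hecke_eq n v u"
| trans: "hecke_eq n u v \<Longrightarrow> hecke_eq n v w \<Longrightarrow> hecke_eq n u w"

definition hecke_class :: "nat \<Rightarrow> nat list \<Rightarrow> nat list set" where
  "hecke_class n u = {v. hecke_eq n u v}"

text \<open>
  The monoid \<open>M\<^sub>n\<close> of positive braid words modulo the braid relations and
  idempotency of the generators.  The lemmas \<open>hecke_eq_iff_ideal\<close> and
  \<open>hecke_monoid_eq_reduced\<close> below identify it with the multiplicative monoid
  of the elements \<open>\<pi>\<^sub>w\<close> of the algebra \<open>H\<^sub>n(0)\<close>.
\<close>

definition hecke_monoid :: "nat \<Rightarrow> nat list set set" where
  "hecke_monoid n = hecke_class n ` words n"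

definition hecke_mult :: "nat \<Rightarrow> nat list set \<Rightarrow> nat list set \<Rightarrow> nat list set" where
  "hecke_mult n x y = (\<Union>u\<in>x. \<Union>v\<in>y. hecke_class n (u @ v))"

definition hecke_one :: "nat \<Rightarrow> nat list set" where
  "hecke_one n = hecke_class n []"

definition hecke_gen :: "nat \<Rightarrow> nat \<Rightarrow> nat list set" where
  "hecke_gen n i = hecke_class n [i]"

text \<open>The inclusion of \<open>M\<^sub>n\<close> into \<open>M\<^sub>m\<close> for \<open>n \<le> m\<close>.\<close>

definition hecke_incl :: "nat \<Rightarrow> nat list set \<Rightarrow> nat list set" where
  "hecke_incl m x = (\<Union>u\<in>x. hecke_class m u)"


subsection \<open>Comparison with the 0-Hecke algebra\<close>

text \<open>
  The free algebra on generators indexed by \<open>{1..<n}\<close> has the words as a basis.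
  The two-sided ideal generated by the differences \<open>a - b\<close> of the two sides of
  the defining relations is the linear span of the elements \<open>u (a - b) v\<close>,
  where \<open>u\<close> and \<open>v\<close> are words; \<open>H\<^sub>n(0)\<close> is the quotient by it.
\<close>

definition vec_scale :: "'k::field \<Rightarrow> ('b \<Rightarrow>\<^sub>0 'k) \<Rightarrow> ('b \<Rightarrow>\<^sub>0 'k)" where
  "vec_scale c v = Poly_Mapping.map ((*) c) v"

lemma vector_space_vec_scale: "vector_space vec_scale"
  unfolding vec_scale_def[abs_def]
proof -
  have l: "Poly_Mapping.lookup (Poly_Mapping.map ((*) c) v) k = c * Poly_Mapping.lookup v k"
    for c :: 'a and v :: "'b \<Rightarrow>\<^sub>0 'a" and k
    by (simp add: Poly_Mapping.map.rep_eq when_def)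
  show "vector_space (\<lambda>c :: 'a. Poly_Mapping.map ((*) c) :: ('b \<Rightarrow>\<^sub>0 'a) \<Rightarrow> _)"
    by unfold_locales (auto intro!: poly_mapping_eqI simp: l lookup_add algebra_simps)
qed

definition hecke_ideal :: "nat \<Rightarrow> (nat list \<Rightarrow>\<^sub>0 'k::field) set" where
  "hecke_ideal n = module.span vec_scale
     {Poly_Mapping.single (u @ a @ v) 1 - Poly_Mapping.single (u @ b @ v) 1 | a b u v.
        (a, b) \<in> hecke_relations n \<and> u \<in> words n \<and> v \<in> words n}"

fun word_perm :: "nat list \<Rightarrow> nat \<Rightarrow> nat" where
  "word_perm [] = id"
| "word_perm (i # u) = transpose i (Suc i) \<circ> word_perm u"

definition reduced_words :: "nat \<Rightarrow> nat list set" where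
  "reduced_words n =
     {u \<in> words n. \<forall>v \<in> words n. word_perm v = word_perm u \<longrightarrow> length u \<le> length v}"

lemma hecke_relations_words: "(a, b) \<in> hecke_relations n \<Longrightarrow> a \<in> words n \<and> b \<in> words n"
  by (auto simp: hecke_relations_def words_def)

lemma words_append: "u @ v \<in> words n \<longleftrightarrow> u \<in> words n \<and> v \<in> words n"
  by (auto simp: words_def)

lemma hecke_eq_words: "hecke_eq n u v \<Longrightarrow> u \<in> words n \<and> v \<in> words n"
  by (induction rule: hecke_eq.induct) (use hecke_relations_words words_append in blast)+

lemma hecke_eq_context:
  assumes "hecke_eq n u v" "p \<in> words n" "q \<in> words n"
  shows "hecke_eq n (p @ u @ q) (p @ v @ q)"
  using assms
proof (induction rule: hecke_eq.induct)
  case (rel a b u v)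
  then have "hecke_eq n ((p @ u) @ a @ (v @ q)) ((p @ u) @ b @ (v @ q))"
    by (intro hecke_eq.rel) (auto simp: words_append)
  then show ?case by simp
qed (auto intro: hecke_eq.intros simp: words_append)

lemma hecke_eq_iff_ideal:
  assumes "u \<in> words n" "v \<in> words n"
  shows "hecke_eq n u v \<longleftrightarrow>
    Poly_Mapping.single u (1 :: 'k::field) - Poly_Mapping.single v 1 \<in> hecke_ideal n"
proof -
  interpret vector_space "vec_scale :: 'k \<Rightarrow> (nat list \<Rightarrow>\<^sub>0 'k) \<Rightarrow> _"
    by (rule vector_space_vec_scale)
  define G where "G = {Poly_Mapping.single (u @ a @ v) (1::'k) - Poly_Mapping.single (u @ b @ v) 1 | a b u v.
        (a, b) \<in> hecke_relations n \<and> u \<in> words n \<and> v \<in> words n}"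
  have I: "hecke_ideal n = span G"
    by (simp add: hecke_ideal_def G_def vec_scale_def[abs_def])
  have "Poly_Mapping.single u (1::'k) - Poly_Mapping.single v 1 \<in> span G" if "hecke_eq n u v" for u v
    using that
  proof (induction rule: hecke_eq.induct)
    case (rel a b u v)
    then show ?case by (intro span_base) (auto simp: G_def)
  next
    case (sym u v)
    then show ?case using span_neg by fastforce
  next
    case (trans u v w)
    then show ?case using span_add by fastforce
  qed (simp add: span_zero)
  moreover have "hecke_eq n u v" if "Poly_Mapping.single u (1::'k) - Poly_Mapping.single v 1 \<in> span G"
  proof -
    define F where "F a = (\<Sum>w. Poly_Mapping.lookup a w when hecke_eq n u w)" for a :: "nat list \<Rightarrow>\<^sub>0 'k"
    have fin: "finite {w. (Poly_Mapping.lookup a w when hecke_eq n u w) \<noteq> 0}" for a :: "nat list \<Rightarrow>\<^sub>0 'k"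
      by (rule finite_subset[of _ "{w. Poly_Mapping.lookup a w \<noteq> 0}"]) auto
    have F_add: "F (a + b) = F a + F b" for a b
      unfolding F_def lookup_add when_add_distrib by (rule Sum_any.distrib[OF fin fin])
    have F_scale: "F (vec_scale c a) = c * F a" for c a
    proof -
      have "F (vec_scale c a) = (\<Sum>w. c * (Poly_Mapping.lookup a w when hecke_eq n u w))"
        unfolding F_def vec_scale_def
        by (intro Sum_any.cong) (auto simp: Poly_Mapping.map.rep_eq when_def)
      also have "\<dots> = c * F a"
        unfolding F_def by (rule Sum_any_right_distrib[symmetric, OF fin])
      finally show ?thesis .
    qed
    have F_single: "F (Poly_Mapping.single w 1) = (1 when hecke_eq n u w)" for w
    proof -
      have "F (Poly_Mapping.single w 1) = (\<Sum>x. (1 when hecke_eq n u x) when w = x)"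
        unfolding F_def by (intro Sum_any.cong) (auto simp: lookup_single when_def)
      then show ?thesis by simp
    qed
    have F_diff: "F (a - b) = F a - F b" for a b
      using F_add[of "a - b" b] by simp
    have "subspace {a. F a = 0}"
      by (rule subspaceI) (auto simp: F_add F_scale, simp add: F_def)
    moreover have "G \<subseteq> {a. F a = 0}"
    proof -
      have "hecke_eq n u (p @ a @ q) \<longleftrightarrow> hecke_eq n u (p @ b @ q)"
        if "(a, b) \<in> hecke_relations n" "p \<in> words n" "q \<in> words n" for a b p q
        using hecke_eq.rel[OF that] by (meson hecke_eq.sym hecke_eq.trans)
      then show ?thesis by (auto simp: G_def F_diff F_single)
    qed
    ultimately have "span G \<subseteq> {a. F a = 0}" by (simp add: span_minimal)
    then have "F (Poly_Mapping.single u 1 - Poly_Mapping.single v 1) = 0" using that by auto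
    then show ?thesis
      using hecke_eq.refl[OF assms(1)] by (auto simp: F_diff F_single when_def split: if_splits)
  qed
  ultimately show ?thesis by (auto simp: I)
qed

text \<open>
  Every word is equal in the monoid to a product of decreasing runs, and such a
  product is reduced because its length is the number of inversions.
\<close>

fun normal_forms :: "nat \<Rightarrow> nat list set" where
  "normal_forms 0 = {[]}"
| "normal_forms (Suc n) = {u @ rev [a..<Suc n] | u a. u \<in> normal_forms n \<and> 1 \<le> a \<and> a \<le> Suc n}"

lemma words_mono: "u \<in> words n \<Longrightarrow> n \<le> m \<Longrightarrow> u \<in> words m"
  by (auto simp: words_def)

lemma hecke_relations_mono: "r \<in> hecke_relations n \<Longrightarrow> n \<le> m \<Longrightarrow> r \<in> hecke_relations m"
  by (fastforce simp: hecke_relations_def)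

lemma hecke_eq_mono: "hecke_eq n u v \<Longrightarrow> n \<le> m \<Longrightarrow> hecke_eq m u v"
  by (induction rule: hecke_eq.induct)
    (blast intro: hecke_eq.intros words_mono hecke_relations_mono)+

lemma normal_form_words: "u \<in> normal_forms n \<Longrightarrow> u \<in> words n"
proof (induction n arbitrary: u)
  case (Suc n)
  then obtain w a where u: "u = w @ rev [a..<Suc n]" "w \<in> normal_forms n" "1 \<le> a"
    by auto
  from Suc.IH[OF u(2)] have "w \<in> words (Suc n)" by (rule words_mono) simp
  with u(1,3) show ?case by (auto simp: words_def)
qed (simp add: words_def)

lemma hecke_eq_commute:
  assumes "j \<in> {1..<n}" "w \<in> words n" "\<forall>i\<in>set w. \<bar>int i - int j\<bar> > 1"
  shows "hecke_eq n (w @ [j]) ([j] @ w)"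
  using assms(2,3)
proof (induction w)
  case Nil
  then show ?case using assms(1) by (auto intro!: hecke_eq.refl simp: words_def)
next
  case (Cons i w)
  have i: "i \<in> {1..<n}" "w \<in> words n" using Cons.prems by (auto simp: words_def)
  have "hecke_eq n ([i] @ (w @ [j]) @ []) ([i] @ ([j] @ w) @ [])"
    by (rule hecke_eq_context) (use Cons i in \<open>auto simp: words_def\<close>)
  moreover have "([i, j], [j, i]) \<in> hecke_relations n"
    using i assms(1) Cons.prems by (auto simp: hecke_relations_def)
  then have "hecke_eq n ([] @ [i, j] @ w) ([] @ [j, i] @ w)"
    by (rule hecke_eq.rel) (use i in \<open>auto simp: words_def\<close>)
  ultimately show ?case by (simp add: hecke_eq.trans)
qed

lemma normal_form_step:
  "u \<in> normal_forms n \<Longrightarrow> j \<in> {1..<n} \<Longrightarrow> \<exists>w\<in>normal_forms n. hecke_eq n (u @ [j]) w"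
proof (induction n arbitrary: u j)
  case (Suc n)
  then obtain w a where u: "u = w @ rev [a..<Suc n]" "w \<in> normal_forms n" "1 \<le> a" "a \<le> Suc n"
    by auto
  have w: "w \<in> words (Suc n)" using normal_form_words[OF u(2)] by (rule words_mono) simp
  have run: "rev [b..<c] \<in> words (Suc n)" if "1 \<le> b" "c \<le> Suc n" for b c
    using that by (auto simp: words_def)
  have j: "[j] \<in> words (Suc n)" "1 \<le> j" "j \<le> n" using Suc.prems by (auto simp: words_def)
  have absorb: "\<exists>w'\<in>normal_forms (Suc n). hecke_eq (Suc n) (u @ [j]) w'"
    if i: "i \<in> {1..<n}" and e: "hecke_eq (Suc n) (rev [a..<Suc n] @ [j]) ([i] @ rev [a..<Suc n])" for i
  proof -
    obtain w' where w': "w' \<in> normal_forms n" "hecke_eq n (w @ [i]) w'"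
      using Suc.IH[OF u(2) i] by blast
    have "hecke_eq (Suc n) (w @ (rev [a..<Suc n] @ [j]) @ []) (w @ ([i] @ rev [a..<Suc n]) @ [])"
      by (rule hecke_eq_context[OF e w]) (simp add: words_def)
    moreover have "hecke_eq (Suc n) ([] @ (w @ [i]) @ rev [a..<Suc n]) ([] @ w' @ rev [a..<Suc n])"
      by (rule hecke_eq_context[OF hecke_eq_mono[OF w'(2)]]) (use run u(3) in \<open>auto simp: words_def\<close>)
    ultimately have "hecke_eq (Suc n) (u @ [j]) (w' @ rev [a..<Suc n])"
      unfolding u(1) append_assoc append_Nil append_Nil2 by (rule hecke_eq.trans)
    then show ?thesis using w'(1) u(3,4) by (auto simp del: upt_Suc)
  qed
  consider "j = a" | "Suc j = a" | "Suc j < a" | "a < j" by linarith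
  then show ?case
  proof cases
    case 1
    have r: "rev [a..<Suc n] = rev [Suc a..<Suc n] @ [a]"
      using 1 j by (simp add: upt_rec[of a "Suc n"] del: upt_Suc)
    have "([a, a], [a]) \<in> hecke_relations (Suc n)"
      using 1 j by (auto simp: hecke_relations_def)
    then have "hecke_eq (Suc n) ((w @ rev [Suc a..<Suc n]) @ [a, a] @ []) ((w @ rev [Suc a..<Suc n]) @ [a] @ [])"
      by (rule hecke_eq.rel) (use w run in \<open>auto simp: words_append words_def\<close>)
    then have "hecke_eq (Suc n) (u @ [j]) u"
      unfolding u(1) r 1 by simp
    then show ?thesis using Suc.prems by blast
  next
    case 2
    have "u @ [j] = w @ rev [j..<Suc n]"
      using 2 j u(1) by (simp add: upt_rec[of j "Suc n"] del: upt_Suc)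
    moreover have "w @ rev [j..<Suc n] \<in> normal_forms (Suc n)" using u(2) j by auto
    ultimately show ?thesis
      using hecke_eq.refl[OF normal_form_words] by metis
  next
    case 3
    show ?thesis
    proof (rule absorb)
      show "j \<in> {1..<n}" using 3 j u(4) by simp
      show "hecke_eq (Suc n) (rev [a..<Suc n] @ [j]) ([j] @ rev [a..<Suc n])"
        by (rule hecke_eq_commute) (use 3 j run u(3) in \<open>auto simp del: upt_Suc\<close>)
    qed
  next
    case 4
    define k where "k = j - 1"
    have k: "j = Suc k" "a \<le> k" using 4 by (auto simp: k_def)
    let ?t = "rev [Suc j..<Suc n]" and ?s = "rev [a..<k]"
    have r: "rev [a..<Suc n] = ?t @ [j, k] @ ?s"
    proof -
      have "[a..<Suc n] = [a..<k] @ [k..<Suc n]"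
        using k j upt_add_eq_append[of a k "Suc n - k"] by simp
      moreover have "[k..<Suc n] = k # j # [Suc j..<Suc n]"
        using k j by (simp add: upt_rec[of k "Suc n"] upt_rec[of "Suc k" "Suc n"] del: upt_Suc)
      ultimately show ?thesis by simp
    qed
    have wt: "?t \<in> words (Suc n)" "?s \<in> words (Suc n)" "[j, k] \<in> words (Suc n)" "[k] \<in> words (Suc n)"
      using run j k u(3) by (auto simp: words_def)
    have "hecke_eq (Suc n) (?s @ [j]) ([j] @ ?s)"
      by (rule hecke_eq_commute) (use j wt(2) in \<open>auto simp: k\<close>)
    then have "hecke_eq (Suc n) ((?t @ [j, k]) @ (?s @ [j]) @ []) ((?t @ [j, k]) @ ([j] @ ?s) @ [])"
      by (rule hecke_eq_context) (use wt in \<open>auto simp: words_append words_def\<close>)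
    then have 1: "hecke_eq (Suc n) (rev [a..<Suc n] @ [j]) (?t @ [j, k, j] @ ?s)"
      by (simp add: r del: upt_Suc)
    have "([k, j, k], [j, k, j]) \<in> hecke_relations (Suc n)"
      using j k u(3) by (auto simp: hecke_relations_def)
    then have "hecke_eq (Suc n) (?t @ [j, k, j] @ ?s) (?t @ [k, j, k] @ ?s)"
      by (intro hecke_eq.sym[OF hecke_eq.rel]) (use wt in auto)
    moreover have "hecke_eq (Suc n) (?t @ [k]) ([k] @ ?t)"
      by (rule hecke_eq_commute) (use j k u(3) wt in auto)
    then have "hecke_eq (Suc n) ([] @ (?t @ [k]) @ ([j, k] @ ?s)) ([] @ ([k] @ ?t) @ ([j, k] @ ?s))"
      by (rule hecke_eq_context) (use wt in \<open>auto simp: words_append words_def\<close>)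
    then have "hecke_eq (Suc n) (?t @ [k, j, k] @ ?s) ([k] @ rev [a..<Suc n])"
      by (simp add: r del: upt_Suc)
    ultimately have e: "hecke_eq (Suc n) (rev [a..<Suc n] @ [j]) ([k] @ rev [a..<Suc n])"
      using 1 by (meson hecke_eq.trans)
    have "k \<in> {1..<n}" using k j u(3) by simp
    then show ?thesis using e by (rule absorb)
  qed
qed simp

lemma normal_form_Nil: "[] \<in> normal_forms n"
proof (induction n)
  case (Suc n)
  then show ?case by (auto intro!: exI[of _ "Suc n"])
qed simp

lemma normal_form_exists: "u \<in> words n \<Longrightarrow> \<exists>w\<in>normal_forms n. hecke_eq n u w"
proof (induction u rule: rev_induct)
  case Nil
  then show ?case using normal_form_Nil hecke_eq.refl by blast
next
  case (snoc j u)
  have j: "u \<in> words n" "j \<in> {1..<n}" using snoc.prems by (auto simp: words_def)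
  obtain w where w: "w \<in> normal_forms n" "hecke_eq n u w" using snoc j by blast
  obtain w' where w': "w' \<in> normal_forms n" "hecke_eq n (w @ [j]) w'" using normal_form_step[OF w(1) j(2)] by blast
  have "hecke_eq n ([] @ u @ [j]) ([] @ w @ [j])"
    by (rule hecke_eq_context[OF w(2)]) (use j in \<open>auto simp: words_def\<close>)
  then have "hecke_eq n (u @ [j]) w'" using w'(2) by (simp add: hecke_eq.trans)
  then show ?case using w'(1) by blast
qed

definition inversions :: "nat \<Rightarrow> (nat \<Rightarrow> nat) \<Rightarrow> (nat \<times> nat) set" where
  "inversions n f = {(x, y). 1 \<le> x \<and> x < y \<and> y \<le> n \<and> f y < f x}"

lemma finite_inversions: "finite (inversions n f)"
  by (rule finite_subset[of _ "{0..n} \<times> {0..n}"]) (auto simp: inversions_def)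

lemma inj_word_perm: "inj (word_perm u)"
  by (induction u) (auto intro!: inj_compose simp del: o_apply)

lemma inversions_le_length: "card (inversions n (word_perm u)) \<le> length u"
proof (induction u)
  case Nil
  have "inversions n id = {}" by (auto simp: inversions_def)
  then show ?case by (simp only: word_perm.simps card.empty)
next
  case (Cons i u)
  let ?f = "word_perm u"
  let ?B = "{(x, y). ?f x = i \<and> ?f y = Suc i}"
  have sub: "inversions n (transpose i (Suc i) \<circ> ?f) \<subseteq> inversions n ?f \<union> ?B"
    by (auto simp: inversions_def transpose_def split: if_splits)
  have "finite ?B \<and> card ?B \<le> 1"
  proof (cases "?B = {}")
    case False
    then obtain p where "p \<in> ?B" by blast
    then have "?B = {p}" using inj_word_perm[of u] by (auto simp: inj_def)
    then show ?thesis by simp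
  qed (simp only: finite.emptyI card.empty, simp)
  then have B: "finite ?B" "card ?B \<le> 1" by auto
  have "card (inversions n (word_perm (i # u))) \<le> card (inversions n ?f \<union> ?B)"
    unfolding word_perm.simps
    by (rule card_mono[OF finite_UnI[OF finite_inversions B(1)] sub])
  also have "\<dots> \<le> card (inversions n ?f) + card ?B" by (rule card_Un_le)
  finally show ?case using Cons B(2) unfolding list.size by linarith
qed

lemma word_perm_append: "word_perm (u @ v) = word_perm u \<circ> word_perm v"
  by (induction u) (auto simp: o_assoc)

lemma word_perm_fix: "u \<in> words n \<Longrightarrow> n < x \<Longrightarrow> word_perm u x = x"
  by (induction u) (auto simp: words_def transpose_def)

lemma word_perm_bound: "u \<in> words n \<Longrightarrow> x \<le> n \<Longrightarrow> word_perm u x \<le> n"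
  by (induction u) (auto simp: words_def transpose_def)

lemma word_perm_run:
  "a \<le> b \<Longrightarrow> word_perm (rev [a..<b]) x = (if x = a then b else if a < x \<and> x \<le> b then x - 1 else x)"
proof (induction b)
  case (Suc b)
  show ?case
  proof (cases "a = Suc b")
    case False
    then have "a \<le> b" using Suc.prems by simp
    then show ?thesis using Suc.IH by (auto simp: transpose_def)
  qed auto
qed auto

lemma normal_form_inversions: "u \<in> normal_forms n \<Longrightarrow> length u \<le> card (inversions n (word_perm u))"
proof (induction n arbitrary: u)
  case (Suc n)
  then obtain w a where u: "u = w @ rev [a..<Suc n]" "w \<in> normal_forms n" "1 \<le> a" "a \<le> Suc n"
    by auto
  let ?f = "word_perm w" and ?g = "word_perm u"
  have W: "w \<in> words n" using normal_form_words[OF u(2)] .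
  have g: "?g x = ?f (if x = a then Suc n else if a < x \<and> x \<le> Suc n then x - 1 else x)" for x
    using word_perm_run[OF u(4), of x] by (simp add: u(1) word_perm_append)
  define d where "d x = (if x < a then x else Suc x)" for x
  have gd: "?g (d x) = ?f x" if "x \<le> n" for x
    using that u(4) by (auto simp: g d_def)
  have ga: "?g a = Suc n" using W by (simp add: g word_perm_fix)
  let ?A = "(\<lambda>(x, y). (d x, d y)) ` inversions n ?f" and ?B = "(\<lambda>y. (a, y)) ` {Suc a..Suc n}"
  have d: "d x < d y" if "x < y" for x y using that by (auto simp: d_def)
  have dinj: "inj d" by (auto simp: inj_def d_def split: if_splits)
  have "?A \<subseteq> inversions (Suc n) ?g"
  proof clarify
    fix x y assume xy: "(x, y) \<in> inversions n ?f"
    then have *: "1 \<le> x" "x < y" "y \<le> n" "?f y < ?f x" by (auto simp: inversions_def)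
    then have "?g (d y) < ?g (d x)" by (simp add: gd)
    moreover have "1 \<le> d x" "d y \<le> Suc n" using * by (auto simp: d_def)
    ultimately show "(d x, d y) \<in> inversions (Suc n) ?g"
      using d[OF *(2)] by (simp add: inversions_def)
  qed
  moreover have "?B \<subseteq> inversions (Suc n) ?g"
  proof clarify
    fix y assume y: "y \<in> {Suc a..Suc n}"
    then have "?g y = ?f (y - 1)" by (simp add: g)
    also have "\<dots> \<le> n" by (rule word_perm_bound[OF W]) (use y in auto)
    finally show "(a, y) \<in> inversions (Suc n) ?g"
      using y u(3) ga by (simp add: inversions_def)
  qed
  ultimately have "card (?A \<union> ?B) \<le> card (inversions (Suc n) ?g)"
    by (intro card_mono) (auto simp: finite_inversions)
  moreover have "card (?A \<union> ?B) = card ?A + card ?B"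
    by (rule card_Un_disjoint) (auto simp: finite_inversions d_def split: if_splits)
  moreover have "card ?A = card (inversions n ?f)"
    using dinj by (intro card_image) (auto simp: inj_on_def inj_def)
  moreover have "card ?B = Suc n - a"
    by (subst card_image) (auto simp: inj_on_def)
  ultimately show ?case using Suc.IH[OF u(2)] u(1,4) by (simp del: upt_Suc)
qed simp

lemma normal_form_reduced:
  assumes "u \<in> normal_forms n"
  shows "u \<in> reduced_words n"
proof -
  have "length u \<le> length v" if "word_perm v = word_perm u" for v
    using normal_form_inversions[OF assms] inversions_le_length[of n v] that by simp
  then show ?thesis
    using normal_form_words[OF assms] by (simp add: reduced_words_def)
qed

lemma hecke_monoid_eq_reduced: "hecke_monoid n = hecke_class n ` reduced_words n"
proof -
  have "\<exists>w\<in>reduced_words n. hecke_class n u = hecke_class n w" if u: "u \<in> words n" for u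
  proof -
    obtain w where w: "w \<in> normal_forms n" "hecke_eq n u w" using normal_form_exists[OF u] by blast
    have "hecke_eq n u x \<longleftrightarrow> hecke_eq n w x" for x
      using w(2) by (meson hecke_eq.trans hecke_eq.sym)
    then show ?thesis using normal_form_reduced[OF w(1)] by (auto simp: hecke_class_def)
  qed
  moreover have "reduced_words n \<subseteq> words n" by (auto simp: reduced_words_def)
  ultimately show ?thesis
    unfolding hecke_monoid_def by (auto simp: image_def)
qed


section \<open>The 0-Hecke category\<close>

text \<open>
  Objects are natural numbers.  The relation \<open>hom_eq n m\<close> is the equivalence
  relation on \<open>M\<^sub>m\<close> generated by \<open>x \<sim> x \<pi>\<^sub>j\<close> for
  \<open>n + 1 \<le> j \<le> m - 1\<close>; morphisms from \<open>n\<close> to \<open>m\<close> are its classes.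
\<close>

inductive hom_eq :: "nat \<Rightarrow> nat \<Rightarrow> nat list set \<Rightarrow> nat list set \<Rightarrow> bool" for n m where
  drop: "x \<in> hecke_monoid m \<Longrightarrow> j \<in> {n + 1..<m} \<Longrightarrow> hom_eq n m x (hecke_mult m x (hecke_gen m j))"
| refl: "x \<in> hecke_monoid m \<Longrightarrow> hom_eq n m x x"
| sym: "hom_eq n m x y \<Longrightarrow> hom_eq n m y x"
| trans: "hom_eq n m x y \<Longrightarrow> hom_eq n m y z \<Longrightarrow> hom_eq n m x z"

type_synonym morphism = "nat list set set"

definition hom_class :: "nat \<Rightarrow> nat \<Rightarrow> nat list set \<Rightarrow> morphism" where
  "hom_class n m x = {y. hom_eq n m x y}"

definition Hom :: "nat \<Rightarrow> nat \<Rightarrow> morphism set" where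
  "Hom n m = (if n \<le> m then hom_class n m ` hecke_monoid m else {})"

text \<open>
  \<open>hom_compose n l g f\<close> is the composite of \<open>f\<close> from \<open>n\<close> to \<open>m\<close> with
  \<open>g\<close> from \<open>m\<close> to \<open>l\<close>.  The union is over representatives and is a single
  class, since the class of \<open>y x\<close> does not depend on them.
\<close>

definition hom_compose :: "nat \<Rightarrow> nat \<Rightarrow> morphism \<Rightarrow> morphism \<Rightarrow> morphism" where
  "hom_compose n l g f = (\<Union>y\<in>g. \<Union>x\<in>f. hom_class n l (hecke_mult l y (hecke_incl l x)))"

definition iota :: "nat \<Rightarrow> nat \<Rightarrow> morphism" where
  "iota n m = hom_class n m (hecke_one m)"

definition end_gen :: "nat \<Rightarrow> nat \<Rightarrow> morphism" where
  "end_gen n j = hom_class n n (hecke_gen n j)"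


section \<open>Modules over the 0-Hecke category\<close>

text \<open>
  A functor to vector spaces.  The spaces \<open>V n\<close> are subspaces of one ambient
  vector space, and \<open>act n m f\<close> only matters on \<open>V n\<close>.
\<close>

locale H_module = vector_space scale
  for scale :: "'k::field \<Rightarrow> 'v::ab_group_add \<Rightarrow> 'v" +
  fixes V :: "nat \<Rightarrow> 'v set"
    and act :: "nat \<Rightarrow> nat \<Rightarrow> morphism \<Rightarrow> 'v \<Rightarrow> 'v"
  assumes subspace_V: "subspace (V n)"
    and act_closed: "f \<in> Hom n m \<Longrightarrow> v \<in> V n \<Longrightarrow> act n m f v \<in> V m"
    and act_add: "f \<in> Hom n m \<Longrightarrow> v \<in> V n \<Longrightarrow> w \<in> V n \<Longrightarrow>
          act n m f (v + w) = act n m f v + act n m f w"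
    and act_scale: "f \<in> Hom n m \<Longrightarrow> v \<in> V n \<Longrightarrow>
          act n m f (scale c v) = scale c (act n m f v)"
    and act_id: "v \<in> V n \<Longrightarrow> act n n (iota n n) v = v"
    and act_compose: "f \<in> Hom n m \<Longrightarrow> g \<in> Hom m l \<Longrightarrow> v \<in> V n \<Longrightarrow>
          act n l (hom_compose n l g f) v = act m l g (act n m f v)"
begin

definition submodule :: "(nat \<Rightarrow> 'v set) \<Rightarrow> bool" where
  "submodule W \<longleftrightarrow>
     (\<forall>n. subspace (W n) \<and> W n \<subseteq> V n) \<and>
     (\<forall>n m. \<forall>f \<in> Hom n m. \<forall>v \<in> W n. act n m f v \<in> W m)"

text \<open>An element is a pair of an object \<open>n\<close> and a vector of \<open>V n\<close>.\<close>

definition finitely_generated :: bool where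
  "finitely_generated \<longleftrightarrow>
     (\<exists>S. finite S \<and> S \<subseteq> Sigma UNIV V \<and>
        (\<forall>W. submodule W \<and> S \<subseteq> Sigma UNIV W \<longrightarrow> W = V))"

end


section \<open>Standard reverse composition tableaux\<close>

definition composition :: "nat \<Rightarrow> nat list \<Rightarrow> bool" where
  "composition n \<alpha> \<longleftrightarrow> (\<forall>a \<in> set \<alpha>. 1 \<le> a) \<and> sum_list \<alpha> = n"

text \<open>Boxes are pairs (row, column), both counted from 1.\<close>

definition diagram :: "nat list \<Rightarrow> (nat \<times> nat) set" where
  "diagram \<alpha> = {(i, j). 1 \<le> i \<and> i \<le> length \<alpha> \<and> 1 \<le> j \<and> j \<le> \<alpha> ! (i - 1)}"

text \<open>Fillings are extended by 0 outside the diagram, so that they are determined by their entries.\<close>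

type_synonym tableau = "nat \<times> nat \<Rightarrow> nat"

definition SRCT :: "nat list \<Rightarrow> tableau set" where
  "SRCT \<alpha> = {T.
     bij_betw T (diagram \<alpha>) {1..sum_list \<alpha>} \<and>
     (\<forall>b. b \<notin> diagram \<alpha> \<longrightarrow> T b = 0) \<and>
     (\<forall>i j k. (i, j) \<in> diagram \<alpha> \<and> (i, k) \<in> diagram \<alpha> \<and> j < k \<longrightarrow> T (i, k) < T (i, j)) \<and>
     (\<forall>i j. (i, 1) \<in> diagram \<alpha> \<and> (j, 1) \<in> diagram \<alpha> \<and> i < j \<longrightarrow> T (i, 1) < T (j, 1)) \<and>
     (\<forall>i j k. i < j \<and> (i, k) \<in> diagram \<alpha> \<and> (j, k + 1) \<in> diagram \<alpha> \<and> T (i, k) > T (j, k + 1) \<longrightarrow>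
        (i, k + 1) \<in> diagram \<alpha> \<and> T (i, k + 1) > T (j, k + 1))}"

definition Des :: "nat list \<Rightarrow> tableau \<Rightarrow> nat set" where
  "Des \<alpha> T = {i \<in> {1..<sum_list \<alpha>}. \<exists>(r, c) \<in> diagram \<alpha>. \<exists>(r', c') \<in> diagram \<alpha>.
     T (r, c) = i \<and> T (r', c') = i + 1 \<and> c \<le> c'}"

definition attacking :: "nat list \<Rightarrow> tableau \<Rightarrow> nat \<Rightarrow> bool" where
  "attacking \<alpha> T i \<longleftrightarrow> (\<exists>(r, c) \<in> diagram \<alpha>. \<exists>(r', c') \<in> diagram \<alpha>.
     T (r, c) = i \<and> T (r', c') = i + 1 \<and> (c' = c \<or> c' = c + 1 \<and> r < r'))"


section \<open>The modules of tableaux\<close>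

text \<open>
  Finitely supported functions on tableaux, with pointwise scalar multiplication;
  the tableau \<open>T\<close> is the basis vector \<open>Poly_Mapping.single T 1\<close>.
\<close>

type_synonym 'k vec = "tableau \<Rightarrow>\<^sub>0 'k"

definition linear_extension :: "(tableau \<Rightarrow> 'k::field vec) \<Rightarrow> 'k vec \<Rightarrow> 'k vec" where
  "linear_extension f v =
     (\<Sum>T \<in> Poly_Mapping.keys v. vec_scale (Poly_Mapping.lookup v T) (f T))"

definition tableau_space :: "nat list \<Rightarrow> 'k::field vec set" where
  "tableau_space \<alpha> = {v. Poly_Mapping.keys v \<subseteq> SRCT \<alpha>}"

definition swap_entries :: "nat \<Rightarrow> tableau \<Rightarrow> tableau" where
  "swap_entries i T = transpose i (i + 1) \<circ> T"

definition pi_tableau :: "nat list \<Rightarrow> nat \<Rightarrow> tableau \<Rightarrow> 'k::field vec" where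
  "pi_tableau \<alpha> i T =
     (if i \<notin> Des \<alpha> T then 0
      else if attacking \<alpha> T i then Poly_Mapping.single T 1
      else Poly_Mapping.single (swap_entries i T) 1 + Poly_Mapping.single T 1)"

definition pi_action :: "nat list \<Rightarrow> nat \<Rightarrow> 'k::field vec \<Rightarrow> 'k vec" where
  "pi_action \<alpha> i = linear_extension (pi_tableau \<alpha> i)"

definition Phi :: "nat list \<Rightarrow> 'k::field vec \<Rightarrow> 'k vec" where
  "Phi \<alpha> = linear_extension
     (\<lambda>T. Poly_Mapping.single (T((length \<alpha> + 1, 1) := sum_list \<alpha> + 1)) 1)"


section \<open>The module \<open>H(V\<^sub>\<tau>)\<close>\<close>

definition HV_shape :: "nat list \<Rightarrow> nat \<Rightarrow> nat list" where
  "HV_shape \<tau> i = \<tau> @ replicate (i - sum_list \<tau>) 1"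

definition HV_space :: "nat list \<Rightarrow> nat \<Rightarrow> 'k::field vec set" where
  "HV_space \<tau> i = (if sum_list \<tau> \<le> i then tableau_space (HV_shape \<tau> i) else {0})"

text \<open>
  The morphisms \<open>end_gen i j\<close> and \<open>iota i (i + 1)\<close> generate the category, so
  these conditions determine \<open>act\<close> on the spaces \<open>HV_space \<tau> i\<close>.
\<close>

definition is_HV :: "nat list \<Rightarrow> (nat \<Rightarrow> nat \<Rightarrow> morphism \<Rightarrow> 'k::field vec \<Rightarrow> 'k vec) \<Rightarrow> bool" where
  "is_HV \<tau> act \<longleftrightarrow>
     H_module vec_scale (HV_space \<tau>) act \<and>
     (\<forall>i \<ge> sum_list \<tau>. \<forall>v \<in> HV_space \<tau> i.
        (\<forall>j \<in> {1..<i}. act i i (end_gen i j) v = pi_action (HV_shape \<tau> i) j v) \<and>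
        act i (i + 1) (iota i (i + 1)) v = Phi (HV_shape \<tau> i) v)"

end

theory Submission
  imports Defs
begin

text \<open>
  Row maxima of a tableau lie in the first column, whose entries increase downwards.  So if the
  last row of the shape is a single box, it contains the largest entry, and \<open>\<Phi>\<^sub>i\<close> is a bijection
  on basis elements for every \<open>i \<ge> n\<close>: the finitely many tableaux of shape \<open>\<tau>\<close> generate.

  The functor exists because a word acts on the iterated image under \<open>\<Phi>\<close> compatibly with all
  relations: the braid relation is a statement about three boxes, \<open>\<pi>\<^sub>j\<close> on old entries commutes
  with \<open>\<Phi>\<close>, and \<open>\<pi>\<^sub>j\<close> on two new entries is the identity, since they attack each other.
\<close>

text \<open>The harder half is existence. A morphism is a class of classes of words, so the action
  is read off a chosen word and must be insensitive to two nested relations: \<open>hecke_eq\<close>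
  between words, and \<open>hom_eq\<close> between monoid elements, which deletes generators on the
  right. The model is the factorisation of the class of x in Hom([n],[m]) as x after the principal
  injection: adjoin m - n boxes, then apply x. To keep the case analysis within reach, a tableau is
  handled through the positions of its entries: descents and attacks at i depend only on the boxes
  of i and i + 1, and a swap exchanges these two boxes. For finite generation \<open>act\<close> is
  arbitrary, so the argument has to work from the conditions in \<open>is_HV\<close> and not from
  the constructed action.\<close>

interpretation vec: vector_space "vec_scale :: 'k::field \<Rightarrow> ('b \<Rightarrow>\<^sub>0 'k) \<Rightarrow> _"
  by (rule vector_space_vec_scale)

section \<open>Linear maps on spaces of tableaux\<close>

lemma lookup_vec_scale [simp]:
  "Poly_Mapping.lookup (vec_scale c v) b = c * Poly_Mapping.lookup v b"
  by (simp add: vec_scale_def Poly_Mapping.map.rep_eq when_def)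

text \<open>Cancellation can make the support of a sum smaller than the union of the supports.
  Summing over a common finite superset makes the sums comparable term by term.\<close>

lemma linear_extension_superset:
  assumes "finite A" "Poly_Mapping.keys v \<subseteq> A"
  shows "linear_extension f v = (\<Sum>T\<in>A. vec_scale (Poly_Mapping.lookup v T) (f T))"
  unfolding linear_extension_def
  by (rule sum.mono_neutral_left) (use assms in \<open>auto simp: in_keys_iff\<close>)

lemma linear_extension_zero [simp]: "linear_extension f 0 = 0"
  by (simp add: linear_extension_def)

lemma linear_extension_add [simp]:
  "linear_extension f (v + w) = linear_extension f v + linear_extension f w"
proof -
  let ?A = "Poly_Mapping.keys v \<union> Poly_Mapping.keys w"
  have "Poly_Mapping.keys (v + w) \<subseteq> ?A" by (rule Poly_Mapping.keys_add)
  then show ?thesis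
    by (simp add: linear_extension_superset[of ?A] lookup_add vec.scale_left_distrib sum.distrib)
qed

lemma linear_extension_scale [simp]:
  "linear_extension f (vec_scale c v) = vec_scale c (linear_extension f v)"
proof -
  have "Poly_Mapping.keys (vec_scale c v) \<subseteq> Poly_Mapping.keys v"
    by (auto simp: in_keys_iff)
  then show ?thesis
    by (simp add: linear_extension_superset[of "Poly_Mapping.keys v"] vec.scale_sum_right)
qed

lemma linear_extension_single [simp]: "linear_extension f (Poly_Mapping.single T 1) = f T"
  by (simp add: linear_extension_def)

lemma subspace_tableau_space: "vec.subspace (tableau_space \<alpha>)"
proof (rule vec.subspaceI)
  show "v + w \<in> tableau_space \<alpha>" if "v \<in> tableau_space \<alpha>" "w \<in> tableau_space \<alpha>" for v w
    using that Poly_Mapping.keys_add[of v w] by (auto simp: tableau_space_def)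
qed (auto simp: tableau_space_def in_keys_iff)

lemma tableau_space_zero [simp]: "0 \<in> tableau_space \<alpha>"
  by (rule vec.subspace_0[OF subspace_tableau_space])

lemma tableau_space_add: "v \<in> tableau_space \<alpha> \<Longrightarrow> w \<in> tableau_space \<alpha> \<Longrightarrow> v + w \<in> tableau_space \<alpha>"
  by (rule vec.subspace_add[OF subspace_tableau_space])

lemma tableau_space_scale: "v \<in> tableau_space \<alpha> \<Longrightarrow> vec_scale c v \<in> tableau_space \<alpha>"
  by (rule vec.subspace_scale[OF subspace_tableau_space])

lemma tableau_space_single: "T \<in> SRCT \<alpha> \<Longrightarrow> Poly_Mapping.single T 1 \<in> tableau_space \<alpha>"
  by (simp add: tableau_space_def)

lemma poly_mapping_expansion:
  "v = (\<Sum>T\<in>Poly_Mapping.keys v. vec_scale (Poly_Mapping.lookup v T) (Poly_Mapping.single T 1))"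
proof (rule poly_mapping_eqI)
  fix b
  have "Poly_Mapping.lookup (\<Sum>T\<in>Poly_Mapping.keys v.
          vec_scale (Poly_Mapping.lookup v T) (Poly_Mapping.single T 1)) b
      = (\<Sum>T\<in>Poly_Mapping.keys v. if T = b then Poly_Mapping.lookup v T else 0)"
    by (simp add: lookup_sum lookup_single when_def if_distrib cong: if_cong)
  also have "\<dots> = Poly_Mapping.lookup v b"
    by (simp add: in_keys_iff)
  finally show "Poly_Mapping.lookup v b = Poly_Mapping.lookup (\<Sum>T\<in>Poly_Mapping.keys v.
          vec_scale (Poly_Mapping.lookup v T) (Poly_Mapping.single T 1)) b" ..
qed

lemma tableau_space_eq_span:
  "tableau_space \<alpha> = vec.span ((\<lambda>T. Poly_Mapping.single T 1) ` SRCT \<alpha>)"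
proof
  show "tableau_space \<alpha> \<subseteq> vec.span ((\<lambda>T. Poly_Mapping.single T (1::'a)) ` SRCT \<alpha>)"
  proof
    fix v :: "'a vec" assume "v \<in> tableau_space \<alpha>"
    then have "(\<Sum>T\<in>Poly_Mapping.keys v. vec_scale (Poly_Mapping.lookup v T) (Poly_Mapping.single T 1))
        \<in> vec.span ((\<lambda>T. Poly_Mapping.single T 1) ` SRCT \<alpha>)"
      by (intro vec.span_sum vec.span_scale vec.span_base) (auto simp: tableau_space_def)
    then show "v \<in> vec.span ((\<lambda>T. Poly_Mapping.single T 1) ` SRCT \<alpha>)"
      using poly_mapping_expansion[of v] by simp
  qed
qed (intro vec.span_minimal subspace_tableau_space, auto intro: tableau_space_single)

text \<open>Reduces identities between linear maps to single tableaux. Membership of the remainder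
  \<open>w\<close> is proved along with \<open>P\<close>, so that closure properties are available
  in the step.\<close>

lemma tableau_space_induct [consumes 1, case_names zero step]:
  assumes "v \<in> tableau_space \<alpha>" and "P 0"
    and "\<And>c T w. T \<in> SRCT \<alpha> \<Longrightarrow> w \<in> tableau_space \<alpha> \<Longrightarrow> P w \<Longrightarrow>
           P (vec_scale c (Poly_Mapping.single T 1) + w)"
  shows "P v"
proof -
  from assms(1) have "v \<in> tableau_space \<alpha> \<and> P v"
    unfolding tableau_space_eq_span[of \<alpha>]
  proof (induction rule: vec.span_induct_alt)
    case (step c x w)
    then show ?case
      unfolding tableau_space_eq_span[of \<alpha>, symmetric]
      using assms(3) by (auto intro: tableau_space_add tableau_space_scale tableau_space_single)
  qed (simp add: assms(2) vec.span_zero)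
  then show ?thesis ..
qed

lemma linear_extension_closed:
  assumes "v \<in> tableau_space \<alpha>" "\<And>T. T \<in> SRCT \<alpha> \<Longrightarrow> f T \<in> tableau_space \<beta>"
  shows "linear_extension f v \<in> tableau_space \<beta>"
  using assms(1)
  by (induction rule: tableau_space_induct)
    (auto intro: tableau_space_add tableau_space_scale assms(2))


section \<open>Swapping adjacent entries of a tableau\<close>

definition box :: "nat list \<Rightarrow> tableau \<Rightarrow> nat \<Rightarrow> nat \<times> nat" where
  "box \<alpha> T = inv_into (diagram \<alpha>) T"

definition attacking_boxes :: "nat \<times> nat \<Rightarrow> nat \<times> nat \<Rightarrow> bool" where
  "attacking_boxes p q \<longleftrightarrow> snd q = snd p \<or> snd q = snd p + 1 \<and> fst p < fst q"

lemma SRCT_bij: "T \<in> SRCT \<alpha> \<Longrightarrow> bij_betw T (diagram \<alpha>) {1..sum_list \<alpha>}"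
  by (simp add: SRCT_def)

lemma SRCT_outside: "T \<in> SRCT \<alpha> \<Longrightarrow> b \<notin> diagram \<alpha> \<Longrightarrow> T b = 0"
  unfolding SRCT_def by blast

lemma SRCT_row:
  "T \<in> SRCT \<alpha> \<Longrightarrow> (r, j) \<in> diagram \<alpha> \<Longrightarrow> (r, k) \<in> diagram \<alpha> \<Longrightarrow> j < k \<Longrightarrow> T (r, k) < T (r, j)"
  unfolding SRCT_def by blast

lemma SRCT_first_column:
  "T \<in> SRCT \<alpha> \<Longrightarrow> (r, 1) \<in> diagram \<alpha> \<Longrightarrow> (r', 1) \<in> diagram \<alpha> \<Longrightarrow> r < r' \<Longrightarrow> T (r, 1) < T (r', 1)"
  unfolding SRCT_def by blast

lemma SRCT_triple:
  assumes "T \<in> SRCT \<alpha>" "r < r'" "(r, k) \<in> diagram \<alpha>" "(r', k + 1) \<in> diagram \<alpha>" "T (r, k) > T (r', k + 1)"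
  shows "(r, k + 1) \<in> diagram \<alpha> \<and> T (r, k + 1) > T (r', k + 1)"
  using assms unfolding SRCT_def by blast

lemma box_eqI: "T \<in> SRCT \<alpha> \<Longrightarrow> b \<in> diagram \<alpha> \<Longrightarrow> T b = e \<Longrightarrow> box \<alpha> T e = b"
  using SRCT_bij unfolding box_def bij_betw_def by (metis inv_into_f_f)

lemma box_props:
  assumes "T \<in> SRCT \<alpha>" "1 \<le> e" "e \<le> sum_list \<alpha>"
  shows "box \<alpha> T e \<in> diagram \<alpha>" "T (box \<alpha> T e) = e"
  using SRCT_bij[OF assms(1)] assms(2,3) unfolding box_def bij_betw_def
  by (auto intro: inv_into_into f_inv_into_f)

lemma SRCT_entry_iff_box:
  "T \<in> SRCT \<alpha> \<Longrightarrow> 1 \<le> e \<Longrightarrow> e \<le> sum_list \<alpha> \<Longrightarrow> b \<in> diagram \<alpha> \<and> T b = e \<longleftrightarrow> b = box \<alpha> T e"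
  using box_props box_eqI by metis

lemma Des_iff_box:
  assumes "T \<in> SRCT \<alpha>" "1 \<le> i" "i < sum_list \<alpha>"
  shows "i \<in> Des \<alpha> T \<longleftrightarrow> snd (box \<alpha> T i) \<le> snd (box \<alpha> T (Suc i))"
proof -
  have "i \<in> Des \<alpha> T \<longleftrightarrow> (\<exists>p q. (p \<in> diagram \<alpha> \<and> T p = i) \<and> (q \<in> diagram \<alpha> \<and> T q = Suc i) \<and> snd p \<le> snd q)"
    using assms(2,3) by (fastforce simp: Des_def)
  then show ?thesis
    using SRCT_entry_iff_box[OF assms(1), of i] SRCT_entry_iff_box[OF assms(1), of "Suc i"] assms(2,3) by simp
qed

lemma attacking_iff_box:
  assumes "T \<in> SRCT \<alpha>" "1 \<le> i" "i < sum_list \<alpha>"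
  shows "attacking \<alpha> T i \<longleftrightarrow> attacking_boxes (box \<alpha> T i) (box \<alpha> T (Suc i))"
proof -
  have "attacking \<alpha> T i \<longleftrightarrow> (\<exists>p q. (p \<in> diagram \<alpha> \<and> T p = i) \<and> (q \<in> diagram \<alpha> \<and> T q = Suc i) \<and> attacking_boxes p q)"
    by (fastforce simp: attacking_def attacking_boxes_def)
  then show ?thesis
    using SRCT_entry_iff_box[OF assms(1), of i] SRCT_entry_iff_box[OF assms(1), of "Suc i"] assms(2,3) by simp
qed

text \<open>With \<open>p\<close> and \<open>q\<close> the boxes of i and i + 1, this is a
  non-attacking descent: \<open>q\<close> is strictly to the right of \<open>p\<close>, and if it is
  in the next column, it is not in a lower row.\<close>

definition swappable :: "nat \<times> nat \<Rightarrow> nat \<times> nat \<Rightarrow> bool" where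
  "swappable p q \<longleftrightarrow> snd p \<le> snd q \<and> \<not> attacking_boxes p q"

text \<open>Each of the two steps moves strictly to the right, so together they move at least two
  columns, where no attack is possible.\<close>

lemma swappable_trans: "swappable p q \<Longrightarrow> swappable q r \<Longrightarrow> swappable p r"
  by (auto simp: swappable_def attacking_boxes_def)

lemma swappable_less: "swappable p q \<Longrightarrow> snd p < snd q"
  by (auto simp: swappable_def attacking_boxes_def)

lemma attacking_boxes_le: "attacking_boxes p q \<Longrightarrow> snd p \<le> snd q"
  by (auto simp: attacking_boxes_def)

lemma pi_tableau_cases:
  assumes "T \<in> SRCT \<alpha>" "1 \<le> i" "i < sum_list \<alpha>"
  shows "snd (box \<alpha> T (Suc i)) < snd (box \<alpha> T i) \<Longrightarrow> pi_tableau \<alpha> i T = 0"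
    and "attacking_boxes (box \<alpha> T i) (box \<alpha> T (Suc i)) \<Longrightarrow> pi_tableau \<alpha> i T = Poly_Mapping.single T 1"
    and "swappable (box \<alpha> T i) (box \<alpha> T (Suc i)) \<Longrightarrow>
      pi_tableau \<alpha> i T = Poly_Mapping.single (swap_entries i T) 1 + Poly_Mapping.single T 1"
  using assms
  by (auto simp: pi_tableau_def Des_iff_box attacking_iff_box swappable_def attacking_boxes_le)

text \<open>A swap reverses no comparison except the one between its own two entries. Hence a
  condition can only break where it compares the boxes \<open>?p\<close> and \<open>?q\<close>, and
  \<open>swappable\<close> excludes each such place.\<close>

lemma swap_SRCT:
  assumes T: "T \<in> SRCT \<alpha>" and i: "1 \<le> i" "i < sum_list \<alpha>"
    and s: "swappable (box \<alpha> T i) (box \<alpha> T (Suc i))"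
  shows "swap_entries i T \<in> SRCT \<alpha>"
proof -
  let ?U = "swap_entries i T" and ?p = "box \<alpha> T i" and ?q = "box \<alpha> T (Suc i)"
  have mono: "?U b < ?U b'"
    if "b \<in> diagram \<alpha>" "b' \<in> diagram \<alpha>" "T b < T b'" "\<not> (b = ?p \<and> b' = ?q)" for b b'
  proof -
    have "\<not> (T b = i \<and> T b' = Suc i)" using that box_eqI[OF T] by metis
    then show ?thesis using that(3) by (auto simp: swap_entries_def transpose_def)
  qed
  have p: "?p \<in> diagram \<alpha>" "T ?p = i" and q: "?q \<in> diagram \<alpha>" "T ?q = Suc i"
    using box_props[OF T] i by auto
  have less: "snd ?p < snd ?q" using swappable_less[OF s] .
  have "bij_betw (transpose i (Suc i)) {1..sum_list \<alpha>} {1..sum_list \<alpha>}"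
    using i by (auto simp: bij_betw_transpose_iff)
  then have "bij_betw ?U (diagram \<alpha>) {1..sum_list \<alpha>}"
    using bij_betw_trans[OF SRCT_bij[OF T]] by (simp add: swap_entries_def)
  moreover have "?U b = 0" if "b \<notin> diagram \<alpha>" for b
    using SRCT_outside[OF T that] i by (simp add: swap_entries_def)
  moreover have "?U (r, k) < ?U (r, j)" if "(r, j) \<in> diagram \<alpha>" "(r, k) \<in> diagram \<alpha>" "j < k" for r j k
  proof (rule mono)
    show "T (r, k) < T (r, j)" using SRCT_row[OF T] that by blast
    show "\<not> ((r, k) = ?p \<and> (r, j) = ?q)" using less that by (metis not_less_iff_gr_or_eq snd_conv)
  qed (use that in auto)
  moreover have "?U (r, 1) < ?U (r', 1)"
    if "(r, 1) \<in> diagram \<alpha>" "(r', 1) \<in> diagram \<alpha>" "r < r'" for r r'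
  proof (rule mono)
    show "T (r, 1) < T (r', 1)" using SRCT_first_column[OF T] that by blast
    show "\<not> ((r, 1) = ?p \<and> (r', 1) = ?q)" using less by (metis less_irrefl snd_conv)
  qed (use that in auto)
  moreover have "(r, k + 1) \<in> diagram \<alpha> \<and> ?U (r, k + 1) > ?U (r', k + 1)"
    if *: "r < r'" "(r, k) \<in> diagram \<alpha>" "(r', k + 1) \<in> diagram \<alpha>" "?U (r, k) > ?U (r', k + 1)" for r r' k
  proof -
    \<comment> \<open>If the inequality were produced by the swap, the two boxes would be
      \<open>?p\<close> and \<open>?q\<close>, in adjacent columns with \<open>?q\<close> lower: an
      attack.\<close>
    have "T (r, k) > T (r', k + 1)"
    proof (rule ccontr)
      assume "\<not> T (r, k) > T (r', k + 1)"
      moreover have "T (r, k) \<noteq> T (r', k + 1)" using *(4) by (auto simp: swap_entries_def)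
      ultimately have "(r, k) = ?p \<and> (r', k + 1) = ?q"
        using mono[of "(r, k)" "(r', k + 1)"] * by auto
      then have "attacking_boxes ?p ?q" using *(1) by (metis attacking_boxes_def fst_conv snd_conv)
      then show False using s by (simp add: swappable_def)
    qed
    then have 1: "(r, k + 1) \<in> diagram \<alpha>" "T (r, k + 1) > T (r', k + 1)"
      using SRCT_triple[OF T *(1-3)] by blast+
    \<comment> \<open>The boxes compared in the conclusion share a column, whereas \<open>?p\<close>
      and \<open>?q\<close> do not.\<close>
    moreover have "\<not> ((r', k + 1) = ?p \<and> (r, k + 1) = ?q)"
      using less by (metis less_irrefl snd_conv)
    ultimately show ?thesis using mono * by blast
  qed
  ultimately show ?thesis unfolding SRCT_def by blast
qed

lemma box_swap:
  assumes "T \<in> SRCT \<alpha>" "1 \<le> i" "i < sum_list \<alpha>" "swap_entries i T \<in> SRCT \<alpha>" "1 \<le> e" "e \<le> sum_list \<alpha>"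
  shows "box \<alpha> (swap_entries i T) e = box \<alpha> T (transpose i (Suc i) e)"
proof (rule box_eqI[OF assms(4)])
  have "1 \<le> transpose i (Suc i) e" "transpose i (Suc i) e \<le> sum_list \<alpha>"
    using assms by (auto simp: transpose_def)
  note b = box_props[OF assms(1) this]
  show "box \<alpha> T (transpose i (Suc i) e) \<in> diagram \<alpha>" by (rule b)
  show "swap_entries i T (box \<alpha> T (transpose i (Suc i) e)) = e"
    using b by (simp add: swap_entries_def)
qed


section \<open>The action of the 0-Hecke monoid\<close>

lemma pi_action_simps [simp]:
  "pi_action \<alpha> i 0 = 0"
  "pi_action \<alpha> i (v + w) = pi_action \<alpha> i v + pi_action \<alpha> i w"
  "pi_action \<alpha> i (vec_scale c v) = vec_scale c (pi_action \<alpha> i v)"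
  "pi_action \<alpha> i (Poly_Mapping.single T 1) = pi_tableau \<alpha> i T"
  by (simp_all add: pi_action_def)

lemma pi_tableau_closed:
  assumes "T \<in> SRCT \<alpha>"
  shows "pi_tableau \<alpha> i T \<in> tableau_space \<alpha>"
proof (cases "i \<in> Des \<alpha> T")
  case True
  then have i: "1 \<le> i" "i < sum_list \<alpha>" by (auto simp: Des_def)
  show ?thesis
    using swap_SRCT[OF assms i] assms True Des_iff_box[OF assms i] attacking_iff_box[OF assms i]
    by (auto simp: pi_tableau_def swappable_def
      intro!: tableau_space_add tableau_space_single)
qed (simp add: pi_tableau_def)

lemma pi_action_closed: "v \<in> tableau_space \<alpha> \<Longrightarrow> pi_action \<alpha> i v \<in> tableau_space \<alpha>"
  unfolding pi_action_def by (rule linear_extension_closed) (auto intro: pi_tableau_closed)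

text \<open>The three cases match the three branches of \<open>pi_tableau\<close>.\<close>

lemma box_relation_cases [case_names left attacking swappable]:
  "(snd q < snd p \<Longrightarrow> P) \<Longrightarrow> (attacking_boxes p q \<Longrightarrow> P) \<Longrightarrow> (swappable p q \<Longrightarrow> P) \<Longrightarrow> P"
  unfolding swappable_def by linarith

text \<open>After a swap, i + 1 lies strictly to the left of i, so the generator kills the swapped
  tableau and only its value on \<open>T\<close> survives.\<close>

lemma pi_idem:
  assumes T: "T \<in> SRCT \<alpha>" and i: "1 \<le> i" "i < sum_list \<alpha>"
  shows "pi_action \<alpha> i (pi_tableau \<alpha> i T) = (pi_tableau \<alpha> i T :: 'k::field vec)"
proof (cases rule: box_relation_cases[of "box \<alpha> T (Suc i)" "box \<alpha> T i"])
  case swappable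
  note S = swap_SRCT[OF T i swappable]
  have "pi_tableau \<alpha> i (swap_entries i T) = (0 :: 'k vec)"
    by (rule pi_tableau_cases(1)[OF S i])
      (use box_swap[OF T i S] i swappable_less[OF swappable] in simp)
  then show ?thesis by (simp add: pi_tableau_cases[OF T i] swappable)
qed (simp_all add: pi_tableau_cases[OF T i])

text \<open>The pairs i, i + 1 and j, j + 1 are disjoint, so a swap of one pair leaves the boxes of
  the other in place and does not change the branch in which the other generator acts.\<close>

lemma pi_commute:
  assumes T: "T \<in> SRCT \<alpha>" and i: "1 \<le> i" "i < sum_list \<alpha>" and j: "1 \<le> j" "j < sum_list \<alpha>"
    and d: "\<bar>int i - int j\<bar> > 1"
  shows "pi_action \<alpha> i (pi_tableau \<alpha> j T) = (pi_action \<alpha> j (pi_tableau \<alpha> i T) :: 'k::field vec)"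
proof -
  have keep: "box \<alpha> (swap_entries k T) l = box \<alpha> T l"
    "box \<alpha> (swap_entries k T) (Suc l) = box \<alpha> T (Suc l)"
    if "k \<in> {i, j}" "l \<in> {i, j}" "k \<noteq> l" "swap_entries k T \<in> SRCT \<alpha>" for k l
    using that d box_swap[OF T, of k] i j by (auto simp: transpose_def)
  have c: "swap_entries i (swap_entries j T) = swap_entries j (swap_entries i T)"
    using d by (auto simp: swap_entries_def transpose_def fun_eq_iff)
  have ne: "i \<noteq> j" using d by auto
  note P = pi_tableau_cases
  note ki = keep[of i j] and kj = keep[of j i]
  show ?thesis
  proof (cases rule: box_relation_cases[of "box \<alpha> T (Suc i)" "box \<alpha> T i"])
    case left
    note 1 = this
    show ?thesis
    proof (cases rule: box_relation_cases[of "box \<alpha> T (Suc j)" "box \<alpha> T j"])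
      case swappable
      show ?thesis using 1 swappable swap_SRCT[OF T j swappable] ne kj
        by (simp add: P[OF T i] P[OF T j] P[OF _ i])
    qed (use 1 in \<open>simp_all add: P[OF T i] P[OF T j]\<close>)
  next
    case attacking
    note 1 = this
    show ?thesis
    proof (cases rule: box_relation_cases[of "box \<alpha> T (Suc j)" "box \<alpha> T j"])
      case swappable
      show ?thesis using 1 swappable swap_SRCT[OF T j swappable] ne kj
        by (simp add: P[OF T i] P[OF T j] P[OF _ i])
    qed (use 1 in \<open>simp_all add: P[OF T i] P[OF T j]\<close>)
  next
    case swappable
    note 1 = this and Si = swap_SRCT[OF T i this]
    show ?thesis
    proof (cases rule: box_relation_cases[of "box \<alpha> T (Suc j)" "box \<alpha> T j"])
      case swappable
      show ?thesis using 1 swappable swap_SRCT[OF T j swappable] Si ne ki kj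
        by (simp add: P[OF T i] P[OF T j] P[OF _ i] P[OF _ j] c add_ac)
    qed (use 1 Si ne ki in \<open>simp_all add: P[OF T i] P[OF T j] P[OF _ j]\<close>)
  qed
qed

text \<open>
  The actions of \<open>\<pi>\<^sub>i\<close> and \<open>\<pi>\<^sub>i\<^sub>+\<^sub>1\<close> only depend on the boxes \<open>X, Y, Z\<close> of
  \<open>i, i + 1, i + 2\<close>, and \<open>swappable\<close> is transitive; this is all that the braid relation needs.
\<close>

lemma pi_braid:
  assumes T: "T \<in> SRCT \<alpha>" and i: "1 \<le> i" "Suc i < sum_list \<alpha>"
  shows "pi_action \<alpha> i (pi_action \<alpha> (Suc i) (pi_tableau \<alpha> i T)) =
         (pi_action \<alpha> (Suc i) (pi_action \<alpha> i (pi_tableau \<alpha> (Suc i) T)) :: 'k::field vec)"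
proof -
  \<comment> \<open>All that is remembered of a tableau is the triple of boxes of i, i + 1, i + 2;
    the swaps permute this triple.\<close>
  define st where "st U X Y Z \<longleftrightarrow> U \<in> SRCT \<alpha> \<and> box \<alpha> U i = X \<and> box \<alpha> U (Suc i) = Y \<and> box \<alpha> U (Suc (Suc i)) = Z"
    for U X Y Z
  let ?s = "swap_entries i" and ?t = "swap_entries (Suc i)"
  let ?p = "pi_tableau \<alpha> i :: _ \<Rightarrow> 'k vec" and ?q = "pi_tableau \<alpha> (Suc i) :: _ \<Rightarrow> 'k vec"
  let ?one = "\<lambda>U. Poly_Mapping.single U (1 :: 'k)"
  have i': "1 \<le> i" "i < sum_list \<alpha>" "1 \<le> Suc i" "Suc i < sum_list \<alpha>" using i by auto
  have p0: "?p U = 0" if "st U X Y Z" "snd Y < snd X" for U X Y Z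
    using that pi_tableau_cases(1)[OF _ i'(1,2)] by (auto simp: st_def)
  have pa: "?p U = ?one U" if "st U X Y Z" "attacking_boxes X Y" for U X Y Z
    using that pi_tableau_cases(2)[OF _ i'(1,2)] by (auto simp: st_def)
  have ps: "?p U = ?one (?s U) + ?one U" if "st U X Y Z" "swappable X Y" for U X Y Z
    using that pi_tableau_cases(3)[OF _ i'(1,2)] by (auto simp: st_def)
  have sw: "st (?s U) Y X Z" if "st U X Y Z" "swappable X Y" for U X Y Z
    using that swap_SRCT[of U \<alpha> i] box_swap[of U \<alpha> i] i' by (auto simp: st_def transpose_def)
  have q0: "?q U = 0" if "st U X Y Z" "snd Z < snd Y" for U X Y Z
    using that pi_tableau_cases(1)[OF _ i'(3,4)] by (auto simp: st_def)
  have qa: "?q U = ?one U" if "st U X Y Z" "attacking_boxes Y Z" for U X Y Z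
    using that pi_tableau_cases(2)[OF _ i'(3,4)] by (auto simp: st_def)
  have qs: "?q U = ?one (?t U) + ?one U" if "st U X Y Z" "swappable Y Z" for U X Y Z
    using that pi_tableau_cases(3)[OF _ i'(3,4)] by (auto simp: st_def)
  have tw: "st (?t U) X Z Y" if "st U X Y Z" "swappable Y Z" for U X Y Z
    using that swap_SRCT[of U \<alpha> "Suc i"] box_swap[of U \<alpha> "Suc i"] i' by (auto simp: st_def transpose_def)
  have sts: "?s (?t (?s T)) = ?t (?s (?t T))"
    by (auto simp: swap_entries_def transpose_def fun_eq_iff)
  obtain X Y Z where T0: "st T X Y Z" using T by (auto simp: st_def)
  note [simp] = p0[OF T0] pa[OF T0] ps[OF T0] q0[OF T0] qa[OF T0] qs[OF T0]
  show ?thesis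
  proof (cases rule: box_relation_cases[of Y X])
    \<comment> \<open>The left-hand side vanishes at once. On the right-hand side, any term that
      survives the middle generator is killed by the last one.\<close>
    case left
    show ?thesis
    proof (cases rule: box_relation_cases[of Z Y])
      case swappable
      note T1 = tw[OF T0 swappable]
      note [simp] = left swappable p0[OF T1] pa[OF T1] ps[OF T1] q0[OF T1 swappable_less[OF swappable]]
      show ?thesis
      proof (cases rule: box_relation_cases[of Z X])
        case swappable
        then show ?thesis using q0[OF sw[OF T1 swappable] left] by simp
      qed simp_all
    qed (simp_all add: left)
  next
    case attacking
    note XY = this
    show ?thesis
    proof (cases rule: box_relation_cases[of Z Y])
      case swappable
      note T1 = tw[OF T0 swappable]
      note [simp] = XY swappable p0[OF T1] pa[OF T1] ps[OF T1] q0[OF T1 swappable_less[OF swappable]]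
      show ?thesis
      proof (cases rule: box_relation_cases[of Z X])
        case left
        \<comment> \<open>This case is contradictory: \<open>X\<close> is weakly left of
          \<open>Y\<close>, which is strictly left of \<open>Z\<close>.\<close>
        then show ?thesis using attacking_boxes_le[OF XY] swappable_less[OF swappable] by simp
      next
        case swappable
        then show ?thesis using qa[OF sw[OF T1 swappable] XY] by simp
      qed simp
    qed (simp_all add: XY)
  next
    case swappable
    note XY = this
    note T1 = sw[OF T0 XY]
    note [simp] = XY q0[OF T1] qa[OF T1] qs[OF T1] p0[OF T1 swappable_less[OF XY]]
    show ?thesis
    proof (cases rule: box_relation_cases[of Z Y])
      case left
      note [simp] = left
      show ?thesis
      proof (cases rule: box_relation_cases[of Z X])
        case swappable
        then show ?thesis using p0[OF tw[OF T1 swappable] left] by simp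
      qed simp_all
    next
      case attacking
      note YZ [simp] = attacking
      show ?thesis
      proof (cases rule: box_relation_cases[of Z X])
        case left
        then show ?thesis using attacking_boxes_le[OF YZ] swappable_less[OF XY] by simp
      next
        case swappable
        then show ?thesis using pa[OF tw[OF T1 swappable] YZ] by simp
      qed simp
    next
      case swappable
      note YZ = this
      \<comment> \<open>All three pairs are swappable, and both sides expand to the sum over the six
        arrangements of the three entries in \<open>X\<close>, \<open>Y\<close>,
        \<open>Z\<close>.\<close>
      note XZ = swappable_trans[OF XY YZ]
      note T2 = tw[OF T0 YZ]
      have "?p (?t T) = ?one (?s (?t T)) + ?one (?t T)" by (rule ps[OF T2 XZ])
      moreover have "?q (?t T) = 0" by (rule q0[OF T2 swappable_less[OF YZ]])
      moreover have "?q (?s (?t T)) = ?one (?t (?s (?t T))) + ?one (?s (?t T))"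
        by (rule qs[OF sw[OF T2 XZ] XY])
      moreover have "?p (?t (?s T)) = ?one (?s (?t (?s T))) + ?one (?t (?s T))"
        by (rule ps[OF tw[OF T1 XZ] YZ])
      ultimately show ?thesis by (simp add: YZ XZ sts add_ac)
    qed
  qed
qed


lemma pi_action_idem:
  assumes "v \<in> tableau_space \<alpha>" "i \<in> {1..<sum_list \<alpha>}"
  shows "pi_action \<alpha> i (pi_action \<alpha> i v) = pi_action \<alpha> i v"
  using assms by (induction rule: tableau_space_induct) (simp_all add: pi_idem)

lemma pi_action_commute:
  assumes "v \<in> tableau_space \<alpha>" "i \<in> {1..<sum_list \<alpha>}" "j \<in> {1..<sum_list \<alpha>}" "\<bar>int i - int j\<bar> > 1"
  shows "pi_action \<alpha> i (pi_action \<alpha> j v) = pi_action \<alpha> j (pi_action \<alpha> i v)"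
  using assms by (induction rule: tableau_space_induct) (simp_all add: pi_commute[of _ \<alpha> i j])

lemma pi_action_braid:
  assumes "v \<in> tableau_space \<alpha>" "i \<in> {1..<sum_list \<alpha>}" "Suc i \<in> {1..<sum_list \<alpha>}"
  shows "pi_action \<alpha> i (pi_action \<alpha> (Suc i) (pi_action \<alpha> i v)) =
    pi_action \<alpha> (Suc i) (pi_action \<alpha> i (pi_action \<alpha> (Suc i) v))"
  using assms by (induction rule: tableau_space_induct) (simp_all add: pi_braid)

section \<open>Words acting on tableaux, the last letter first\<close>

fun word_action :: "nat list \<Rightarrow> nat list \<Rightarrow> 'k::field vec \<Rightarrow> 'k vec" where
  "word_action \<alpha> [] v = v"
| "word_action \<alpha> (i # u) v = pi_action \<alpha> i (word_action \<alpha> u v)"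

lemma word_action_linear [simp]:
  "word_action \<alpha> u 0 = 0"
  "word_action \<alpha> u (v + w) = word_action \<alpha> u v + word_action \<alpha> u w"
  "word_action \<alpha> u (vec_scale c v) = vec_scale c (word_action \<alpha> u v)"
  by (induction u) simp_all

lemma word_action_append: "word_action \<alpha> (u @ w) v = word_action \<alpha> u (word_action \<alpha> w v)"
  by (induction u) simp_all

lemma word_action_closed: "v \<in> tableau_space \<alpha> \<Longrightarrow> word_action \<alpha> u v \<in> tableau_space \<alpha>"
  by (induction u) (auto intro: pi_action_closed)

text \<open>The defining relations hold on the whole tableau space, which is stable under words; so
  they may be applied between any prefix and suffix.\<close>

lemma word_action_hecke_eq:
  assumes "hecke_eq (sum_list \<alpha>) u w" "v \<in> tableau_space \<alpha>"
  shows "word_action \<alpha> u v = word_action \<alpha> w v"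
  using assms
proof (induction arbitrary: v rule: hecke_eq.induct)
  case (rel a b p q)
  have "word_action \<alpha> a x = word_action \<alpha> b x" if "x \<in> tableau_space \<alpha>" for x :: "'a vec"
    using rel(1) that unfolding hecke_relations_def
    by (auto simp: pi_action_idem pi_action_braid intro!: pi_action_commute)
  then show ?case using rel.prems by (simp add: word_action_append word_action_closed)
qed auto


section \<open>Adding a box to the first column\<close>

definition add_box :: "nat list \<Rightarrow> tableau \<Rightarrow> tableau" where
  "add_box \<alpha> T = T((length \<alpha> + 1, 1) := sum_list \<alpha> + 1)"

text \<open>The new row is written \<open>Suc 0\<close> because the simplifier rewrites 1 to this
  form.\<close>

lemma diagram_snoc: "diagram (\<alpha> @ [Suc 0]) = insert (length \<alpha> + 1, 1) (diagram \<alpha>)"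
  by (auto simp: diagram_def nth_append split: if_splits)

lemma diagram_bounds: "(r, c) \<in> diagram \<alpha> \<Longrightarrow> 1 \<le> r \<and> r \<le> length \<alpha> \<and> 1 \<le> c"
  by (auto simp: diagram_def)

lemma diagram_first_column: "(r, c) \<in> diagram \<alpha> \<Longrightarrow> (r, 1) \<in> diagram \<alpha>"
  by (auto simp: diagram_def)

lemma SRCT_entry_range: "T \<in> SRCT \<alpha> \<Longrightarrow> b \<in> diagram \<alpha> \<Longrightarrow> 1 \<le> T b \<and> T b \<le> sum_list \<alpha>"
  using bij_betwE[OF SRCT_bij] by fastforce

text \<open>The new box is alone in the lowest row, so it takes part in no row comparison. Nor does
  it occur in the hypothesis of the triple condition: its upper box has a row below it, and its
  lower box is in column 2 or later.\<close>

lemma add_box_SRCT: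
  assumes T: "T \<in> SRCT \<alpha>"
  shows "add_box \<alpha> T \<in> SRCT (\<alpha> @ [Suc 0])"
proof -
  let ?U = "add_box \<alpha> T" and ?n = "(length \<alpha> + 1, 1 :: nat)" and ?D = "diagram (\<alpha> @ [Suc 0])"
  have n: "?n \<notin> diagram \<alpha>" by (auto dest: diagram_bounds)
  have old: "?U b = T b" if "b \<in> diagram \<alpha>" for b using that n by (auto simp: add_box_def)
  have "bij_betw ?U (diagram \<alpha> \<union> {?n}) ({1..sum_list \<alpha>} \<union> {sum_list \<alpha> + 1})"
  proof (rule bij_betw_combine)
    show "bij_betw ?U (diagram \<alpha>) {1..sum_list \<alpha>}"
      using SRCT_bij[OF T] old by (simp cong: bij_betw_cong)
  qed (simp_all add: add_box_def)
  moreover have "{1..sum_list \<alpha>} \<union> {sum_list \<alpha> + 1} = {1..sum_list (\<alpha> @ [Suc 0])}" by auto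
  ultimately have "bij_betw ?U ?D {1..sum_list (\<alpha> @ [Suc 0])}"
    by (simp add: diagram_snoc)
  moreover have "?U b = 0" if "b \<notin> ?D" for b
    using that SRCT_outside[OF T] by (auto simp: diagram_snoc add_box_def)
  moreover have "?U (r, k) < ?U (r, j)" if "(r, j) \<in> ?D" "(r, k) \<in> ?D" "j < k" for r j k
  proof -
    have "(r, j) \<in> diagram \<alpha>" "(r, k) \<in> diagram \<alpha>"
      using that by (auto simp: diagram_snoc dest: diagram_bounds)
    then show ?thesis using SRCT_row[OF T] that(3) by (simp add: old)
  qed
  moreover have "?U (r, 1) < ?U (r', 1)" if "(r, 1) \<in> ?D" "(r', 1) \<in> ?D" "r < r'" for r r'
  proof -
    have r: "(r, 1) \<in> diagram \<alpha>"
      using that by (auto simp: diagram_snoc dest: diagram_bounds)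
    show ?thesis
    proof (cases "r' = length \<alpha> + 1")
      case True
      then show ?thesis using SRCT_entry_range[OF T r] old[OF r] by (simp add: add_box_def)
    next
      case False
      then have "(r', 1) \<in> diagram \<alpha>" using that by (simp add: diagram_snoc)
      then show ?thesis using SRCT_first_column[OF T r _ that(3)] old[OF r] old[of "(r', 1)"] by simp
    qed
  qed
  moreover have "(r, k + 1) \<in> ?D \<and> ?U (r, k + 1) > ?U (r', k + 1)"
    if "r < r'" "(r, k) \<in> ?D" "(r', k + 1) \<in> ?D" "?U (r, k) > ?U (r', k + 1)" for r r' k
  proof -
    have 1: "(r, k) \<in> diagram \<alpha>" "(r', k + 1) \<in> diagram \<alpha>"
      using that(1-3) by (auto simp: diagram_snoc dest: diagram_bounds)
    then have "T (r, k) > T (r', k + 1)" using that(4) by (simp add: old)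
    then have "(r, k + 1) \<in> diagram \<alpha> \<and> T (r, k + 1) > T (r', k + 1)"
      using SRCT_triple[OF T that(1) 1] by blast
    then show ?thesis using 1 by (simp add: old diagram_snoc)
  qed
  ultimately show ?thesis unfolding SRCT_def by blast
qed

text \<open>Once the largest entry is known to sit in the last box, erasing that box leaves exactly
  the entries of a tableau of shape \<open>\<alpha>\<close>.\<close>

lemma SRCT_snoc_obtain:
  assumes U: "U \<in> SRCT (\<alpha> @ [Suc 0])"
  obtains T where "T \<in> SRCT \<alpha>" "U = add_box \<alpha> T"
proof -
  let ?n = "(length \<alpha> + 1, 1 :: nat)" and ?D = "diagram (\<alpha> @ [Suc 0])"
  define T where "T = U(?n := 0)"
  have n: "?n \<notin> diagram \<alpha>" by (auto dest: diagram_bounds)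
  have old: "T b = U b" if "b \<in> diagram \<alpha>" for b using that n by (auto simp: T_def)
  obtain r c where rc: "(r, c) \<in> ?D" "U (r, c) = sum_list \<alpha> + 1"
    using box_props[OF U, of "sum_list \<alpha> + 1"] by (cases "box (\<alpha> @ [Suc 0]) U (sum_list \<alpha> + 1)") auto
  have max: "U b \<le> sum_list \<alpha> + 1" if "b \<in> ?D" for b using SRCT_entry_range[OF U that] by simp
  have "c = 1"
  proof (rule ccontr)
    assume "c \<noteq> 1"
    then have "U (r, c) < U (r, 1)"
      using SRCT_row[OF U diagram_first_column[OF rc(1)] rc(1)] diagram_bounds[OF rc(1)] by simp
    then show False using max[OF diagram_first_column[OF rc(1)]] rc(2) by simp
  qed
  moreover have "r = length \<alpha> + 1"
  proof (rule ccontr)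
    assume "r \<noteq> length \<alpha> + 1"
    then have "r < length \<alpha> + 1" using diagram_bounds[OF rc(1)] by simp
    then have "U (r, 1) < U ?n"
      using SRCT_first_column[OF U] rc(1) \<open>c = 1\<close> by (simp add: diagram_snoc)
    then show False using max[of ?n] rc(2) \<open>c = 1\<close> by (simp add: diagram_snoc)
  qed
  ultimately have Un: "U ?n = sum_list \<alpha> + 1" using rc by simp
  have "bij_betw U (?D - {?n}) ({1..sum_list (\<alpha> @ [Suc 0])} - {U ?n})"
    using SRCT_bij[OF U] by (intro bij_betw_DiffI) (auto simp: diagram_snoc Un[simplified])
  moreover have "?D - {?n} = diagram \<alpha>" "{1..sum_list (\<alpha> @ [Suc 0])} - {U ?n} = {1..sum_list \<alpha>}"
    using n by (auto simp: diagram_snoc Un[simplified])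
  ultimately have "bij_betw U (diagram \<alpha>) {1..sum_list \<alpha>}" by metis
  then have "bij_betw T (diagram \<alpha>) {1..sum_list \<alpha>}"
    using old by (simp cong: bij_betw_cong)
  moreover have "T b = 0" if "b \<notin> diagram \<alpha>" for b
    using that SRCT_outside[OF U, of b] by (auto simp: T_def diagram_snoc)
  moreover have "T (r, k) < T (r, j)" if "(r, j) \<in> diagram \<alpha>" "(r, k) \<in> diagram \<alpha>" "j < k" for r j k
    using SRCT_row[OF U, of r j k] that by (simp add: old diagram_snoc)
  moreover have "T (r, 1) < T (r', 1)" if "(r, 1) \<in> diagram \<alpha>" "(r', 1) \<in> diagram \<alpha>" "r < r'" for r r'
    using SRCT_first_column[OF U, of r r'] that old[of "(r, 1)"] old[of "(r', 1)"] by (simp add: diagram_snoc)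
  moreover have "(r, k + 1) \<in> diagram \<alpha> \<and> T (r, k + 1) > T (r', k + 1)"
    if *: "r < r'" "(r, k) \<in> diagram \<alpha>" "(r', k + 1) \<in> diagram \<alpha>" "T (r, k) > T (r', k + 1)" for r r' k
  proof -
    have D: "b \<in> ?D" if "b \<in> diagram \<alpha>" for b using that by (simp add: diagram_snoc)
    have "(r, k + 1) \<in> ?D \<and> U (r, k + 1) > U (r', k + 1)"
      using SRCT_triple[OF U *(1) D[OF *(2)] D[OF *(3)]] *(4) old[OF *(2)] old[OF *(3)] by simp
    \<comment> \<open>The triple condition asserts that a box exists. It lies in column 2 or later,
      so it is not the erased one.\<close>
    moreover have "(r, k + 1) \<noteq> ?n" using diagram_bounds[OF *(2)] by auto
    ultimately have "(r, k + 1) \<in> diagram \<alpha>" "U (r, k + 1) > U (r', k + 1)" by (auto simp: diagram_snoc)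
    then show ?thesis using *(3) by (simp add: old)
  qed
  ultimately have "T \<in> SRCT \<alpha>" unfolding SRCT_def by blast
  moreover have "U = add_box \<alpha> T" using Un by (auto simp: add_box_def T_def)
  ultimately show ?thesis by (rule that)
qed

text \<open>Fillings vanish outside the finite diagram and take finitely many values on it, which
  leaves finitely many candidates.\<close>

lemma finite_SRCT: "finite (SRCT \<alpha>)"
proof (rule finite_subset)
  have "diagram \<alpha> \<subseteq> {1..length \<alpha>} \<times> (\<Union>a\<in>set \<alpha>. {1..a})"
    by (fastforce simp: diagram_def)
  then have "finite (diagram \<alpha>)" by (rule finite_subset) auto
  then show "finite {T. \<forall>b. (b \<in> diagram \<alpha> \<longrightarrow> T b \<in> {1..sum_list \<alpha>}) \<and> (b \<notin> diagram \<alpha> \<longrightarrow> T b = 0)}"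
    by (rule finite_set_of_finite_funs) simp
  show "SRCT \<alpha> \<subseteq> {T. \<forall>b. (b \<in> diagram \<alpha> \<longrightarrow> T b \<in> {1..sum_list \<alpha>}) \<and> (b \<notin> diagram \<alpha> \<longrightarrow> T b = 0)}"
    using SRCT_entry_range SRCT_outside by fastforce
qed

lemma Phi_simps [simp]:
  "Phi \<alpha> 0 = 0"
  "Phi \<alpha> (v + w) = Phi \<alpha> v + Phi \<alpha> w"
  "Phi \<alpha> (vec_scale c v) = vec_scale c (Phi \<alpha> v)"
  "Phi \<alpha> (Poly_Mapping.single T 1) = Poly_Mapping.single (add_box \<alpha> T) 1"
  by (simp_all add: Phi_def add_box_def)

lemma Phi_closed: "v \<in> tableau_space \<alpha> \<Longrightarrow> Phi \<alpha> v \<in> tableau_space (\<alpha> @ [Suc 0])"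
  by (induction rule: tableau_space_induct)
    (auto intro: tableau_space_add tableau_space_scale tableau_space_single add_box_SRCT)

lemma Phi_surj:
  "v \<in> tableau_space (\<alpha> @ [Suc 0]) \<Longrightarrow> \<exists>w \<in> tableau_space \<alpha>. v = Phi \<alpha> w"
proof (induction rule: tableau_space_induct)
  case zero
  show ?case by (rule bexI[of _ 0]) auto
next
  case (step c U v)
  then obtain w where w: "w \<in> tableau_space \<alpha>" "v = Phi \<alpha> w" by blast
  obtain T where T: "T \<in> SRCT \<alpha>" "U = add_box \<alpha> T" using step(1) by (rule SRCT_snoc_obtain)
  have "vec_scale c (Poly_Mapping.single T 1) + w \<in> tableau_space \<alpha>"
    using w T by (intro tableau_space_add tableau_space_scale tableau_space_single)
  then show ?case using w(2) T(2) by (intro bexI) auto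
qed

section \<open>Compatibility of the generators with the added box\<close>

lemma box_add_box:
  assumes "T \<in> SRCT \<alpha>"
  shows "1 \<le> e \<Longrightarrow> e \<le> sum_list \<alpha> \<Longrightarrow> box (\<alpha> @ [Suc 0]) (add_box \<alpha> T) e = box \<alpha> T e"
    and "box (\<alpha> @ [Suc 0]) (add_box \<alpha> T) (Suc (sum_list \<alpha>)) = (length \<alpha> + 1, 1)"
proof -
  note U = add_box_SRCT[OF assms]
  have n: "(length \<alpha> + 1, 1) \<notin> diagram \<alpha>" by (auto dest: diagram_bounds)
  show "box (\<alpha> @ [Suc 0]) (add_box \<alpha> T) e = box \<alpha> T e" if e: "1 \<le> e" "e \<le> sum_list \<alpha>"
    using box_props[OF assms e] n
    by (intro box_eqI[OF U]) (auto simp: diagram_snoc add_box_def)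
  show "box (\<alpha> @ [Suc 0]) (add_box \<alpha> T) (Suc (sum_list \<alpha>)) = (length \<alpha> + 1, 1)"
    by (rule box_eqI[OF U]) (auto simp: diagram_snoc add_box_def)
qed

text \<open>Since i is below the sum of \<open>\<alpha>\<close>, both i and i + 1 are old entries in
  unchanged boxes, and the same branch of \<open>pi_tableau\<close> applies on both sides.\<close>

lemma pi_tableau_add_box:
  assumes T: "T \<in> SRCT \<alpha>" and i: "i \<in> {1..<sum_list \<alpha>}"
  shows "pi_tableau (\<alpha> @ [Suc 0]) i (add_box \<alpha> T) = (Phi \<alpha> (pi_tableau \<alpha> i T) :: 'k::field vec)"
proof -
  have i': "1 \<le> i" "i < sum_list \<alpha>" "i < sum_list (\<alpha> @ [Suc 0])" using i by auto
  have s: "swap_entries i (add_box \<alpha> T) = add_box \<alpha> (swap_entries i T)"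
    using i' by (auto simp: swap_entries_def add_box_def transpose_def fun_eq_iff)
  note U = pi_tableau_cases[OF add_box_SRCT[OF T] i'(1,3)] and T' = pi_tableau_cases[OF T i'(1,2)]
  note b = box_add_box(1)[OF T, of i] box_add_box(1)[OF T, of "Suc i"]
  show ?thesis
    by (cases rule: box_relation_cases[of "box \<alpha> T (Suc i)" "box \<alpha> T i"])
      (use i' b in \<open>simp_all add: U T' s\<close>)
qed

lemma pi_action_Phi:
  assumes "v \<in> tableau_space \<alpha>" "i \<in> {1..<sum_list \<alpha>}"
  shows "pi_action (\<alpha> @ [Suc 0]) i (Phi \<alpha> v) = Phi \<alpha> (pi_action \<alpha> i v)"
  using assms by (induction rule: tableau_space_induct) (simp_all add: pi_tableau_add_box)

lemma word_action_Phi: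
  assumes "v \<in> tableau_space \<alpha>" "u \<in> words (sum_list \<alpha>)"
  shows "word_action (\<alpha> @ [Suc 0]) u (Phi \<alpha> v) = Phi \<alpha> (word_action \<alpha> u v)"
  using assms(2)
  by (induction u) (auto simp: words_def pi_action_Phi word_action_closed assms(1))

text \<open>The two new entries are in the first column, hence an attacking descent.\<close>

lemma pi_action_Phi_Phi:
  assumes "v \<in> tableau_space \<alpha>"
  shows "pi_action (\<alpha> @ [Suc 0, Suc 0]) (Suc (sum_list \<alpha>)) (Phi (\<alpha> @ [Suc 0]) (Phi \<alpha> v)) = Phi (\<alpha> @ [Suc 0]) (Phi \<alpha> v)"
  using assms
proof (induction rule: tableau_space_induct)
  case (step c T w)
  let ?T = "add_box \<alpha> T"
  note T = add_box_SRCT[OF step(1)]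
  have "box (\<alpha> @ [Suc 0, Suc 0]) (add_box (\<alpha> @ [Suc 0]) ?T) (Suc (sum_list \<alpha>)) = (length \<alpha> + 1, 1)"
    using box_add_box(1)[OF T, of "Suc (sum_list \<alpha>)"] box_add_box(2)[OF step(1)] by simp
  moreover have "box (\<alpha> @ [Suc 0, Suc 0]) (add_box (\<alpha> @ [Suc 0]) ?T) (Suc (Suc (sum_list \<alpha>))) = (length \<alpha> + 2, 1)"
    using box_add_box(2)[OF T] by simp
  ultimately have "pi_tableau (\<alpha> @ [Suc 0, Suc 0]) (Suc (sum_list \<alpha>)) (add_box (\<alpha> @ [Suc 0]) ?T) =
      Poly_Mapping.single (add_box (\<alpha> @ [Suc 0]) ?T) (1 :: 'a)"
    using add_box_SRCT[OF T] by (intro pi_tableau_cases(2)) (auto simp: attacking_boxes_def)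
  then show ?case using step(3) by simp
qed simp


section \<open>Composition of morphisms on representing words\<close>

lemma hecke_class_eq_iff:
  "u \<in> words m \<Longrightarrow> hecke_class m u = hecke_class m w \<longleftrightarrow> hecke_eq m u w"
  unfolding hecke_class_def set_eq_iff mem_Collect_eq
  by (meson hecke_eq.refl hecke_eq.sym hecke_eq.trans)

lemma hecke_class_mem: "u \<in> words m \<Longrightarrow> u \<in> hecke_class m u"
  by (simp add: hecke_class_def hecke_eq.refl)

lemma hecke_class_monoid: "u \<in> words m \<Longrightarrow> hecke_class m u \<in> hecke_monoid m"
  by (simp add: hecke_monoid_def)

lemma hecke_eq_append:
  "hecke_eq m u u' \<Longrightarrow> hecke_eq m w w' \<Longrightarrow> hecke_eq m (u @ w) (u' @ w')"
  using hecke_eq_context[of m u u' "[]" w] hecke_eq_context[of m w w' u' "[]"]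
    hecke_eq_words[of m u u'] hecke_eq_words[of m w w'] hecke_eq.trans
  by (fastforce simp: words_def)

text \<open>\<open>hecke_eq\<close> is a congruence, so all classes in the union that defines
  \<open>hecke_mult\<close> coincide.\<close>

lemma hecke_mult_class:
  assumes "u \<in> words m" "w \<in> words m"
  shows "hecke_mult m (hecke_class m u) (hecke_class m w) = hecke_class m (u @ w)"
proof -
  have "hecke_class m (u' @ w') = hecke_class m (u @ w)"
    if "u' \<in> hecke_class m u" "w' \<in> hecke_class m w" for u' w'
  proof -
    have "hecke_eq m (u @ w) (u' @ w')"
      using that unfolding hecke_class_def by (blast intro: hecke_eq_append)
    then show ?thesis using hecke_class_eq_iff[of "u @ w" m "u' @ w'"] assms by (simp add: words_append)
  qed
  then show ?thesis
    using hecke_class_mem[OF assms(1)] hecke_class_mem[OF assms(2)] unfolding hecke_mult_def by blast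
qed

lemma hecke_incl_class:
  assumes "u \<in> words m" "m \<le> l"
  shows "hecke_incl l (hecke_class m u) = hecke_class l u"
proof -
  have "hecke_class l u' = hecke_class l u" if "u' \<in> hecke_class m u" for u'
  proof -
    have "hecke_eq l u u'"
      using that hecke_eq_mono[OF _ assms(2)] by (simp add: hecke_class_def)
    then show ?thesis using hecke_class_eq_iff[OF words_mono[OF assms], of u'] by simp
  qed
  then show ?thesis
    using hecke_class_mem[OF assms(1)] unfolding hecke_incl_def by blast
qed

lemma hom_eq_monoid: "hom_eq n m x y \<Longrightarrow> x \<in> hecke_monoid m \<and> y \<in> hecke_monoid m"
proof (induction rule: hom_eq.induct)
  case (drop x j)
  then obtain u where u: "u \<in> words m" "x = hecke_class m u" by (auto simp: hecke_monoid_def)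
  have "[j] \<in> words m" using drop(2) by (auto simp: words_def)
  then show ?case
    using u by (simp add: hecke_gen_def hecke_mult_class hecke_class_monoid words_append)
qed auto

lemma hom_class_eq_iff: "x \<in> hecke_monoid m \<Longrightarrow> hom_class n m x = hom_class n m y \<longleftrightarrow> hom_eq n m x y"
  unfolding hom_class_def set_eq_iff mem_Collect_eq
  by (meson hom_eq.refl hom_eq.sym hom_eq.trans)

lemma hom_class_mem: "x \<in> hecke_monoid m \<Longrightarrow> x \<in> hom_class n m x"
  by (simp add: hom_class_def hom_eq.refl)

lemma hom_eq_drop_word:
  assumes "u \<in> words m" "j \<in> {n + 1..<m}"
  shows "hom_eq n m (hecke_class m u) (hecke_class m (u @ [j]))"
proof -
  have "[j] \<in> words m" using assms(2) by (auto simp: words_def)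
  then show ?thesis
    using hom_eq.drop[OF hecke_class_monoid[OF assms(1)] assms(2)] assms(1)
    by (simp add: hecke_gen_def hecke_mult_class)
qed

text \<open>Dropping \<open>\<pi>\<^sub>j\<close> with \<open>j > m\<close> is possible in a product, because \<open>\<pi>\<^sub>j\<close> commutes with \<open>M\<^sub>m\<close>.\<close>

lemma hom_eq_mult_right:
  assumes "hom_eq m l y y'" "w \<in> words m" "n \<le> m" "m \<le> l"
  shows "hom_eq n l (hecke_mult l y (hecke_class l w)) (hecke_mult l y' (hecke_class l w))"
  using assms(1)
proof (induction rule: hom_eq.induct)
  case (drop y j)
  then obtain u where u: "u \<in> words l" "y = hecke_class l u" by (auto simp: hecke_monoid_def)
  have w: "w \<in> words l" using assms(2,4) by (rule words_mono)
  have j: "[j] \<in> words l" using drop(2) by (auto simp: words_def)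
  have "hecke_eq l (w @ [j]) ([j] @ w)"
    using drop(2) assms(2) w by (intro hecke_eq_commute) (auto simp: words_def)
  then have "hecke_eq l (u @ (w @ [j])) (u @ ([j] @ w))"
    by (rule hecke_eq_append[OF hecke_eq.refl[OF u(1)]])
  then have "hecke_class l ((u @ w) @ [j]) = hecke_class l ((u @ [j]) @ w)"
    using u(1) w j hecke_class_eq_iff[of "(u @ w) @ [j]" l "(u @ [j]) @ w"] by (simp add: words_append)
  moreover have "hom_eq n l (hecke_class l (u @ w)) (hecke_class l ((u @ w) @ [j]))"
    using u(1) w drop(2) assms(3) by (intro hom_eq_drop_word) (auto simp: words_append)
  ultimately show ?case
    using u w j by (simp add: hecke_gen_def hecke_mult_class words_append)
next
  case (refl y)
  then obtain u where "u \<in> words l" "y = hecke_class l u" by (auto simp: hecke_monoid_def)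
  then show ?case using words_mono[OF assms(2,4)]
    by (auto simp: hecke_mult_class words_append intro!: hom_eq.refl hecke_class_monoid)
qed (blast intro: hom_eq.sym hom_eq.trans)+

text \<open>The dropped letter stays at the right end of the product, and its index remains in the
  admissible range because m \<le> l.\<close>

lemma hom_eq_mult_left:
  assumes "hom_eq n m x x'" "u \<in> words l" "m \<le> l"
  shows "hom_eq n l (hecke_mult l (hecke_class l u) (hecke_incl l x))
    (hecke_mult l (hecke_class l u) (hecke_incl l x'))"
  using assms(1)
proof (induction rule: hom_eq.induct)
  case (drop x j)
  then obtain w where w: "w \<in> words m" "x = hecke_class m w" by (auto simp: hecke_monoid_def)
  have wl: "w \<in> words l" using w(1) assms(3) by (rule words_mono)
  have j: "[j] \<in> words m" using drop(2) by (auto simp: words_def)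
  have jl: "[j] \<in> words l" using j assms(3) by (rule words_mono)
  have "hom_eq n l (hecke_class l (u @ w)) (hecke_class l ((u @ w) @ [j]))"
    using assms wl drop(2) by (intro hom_eq_drop_word) (auto simp: words_append)
  then show ?case
    using w wl j jl assms(2,3)
    by (simp add: hecke_gen_def hecke_mult_class words_append hecke_incl_class)
next
  case (refl x)
  then obtain w where w: "w \<in> words m" "x = hecke_class m w" by (auto simp: hecke_monoid_def)
  then show ?case using words_mono[OF w(1) assms(3)] assms(2,3)
    by (auto simp: hecke_mult_class hecke_incl_class words_append intro!: hom_eq.refl hecke_class_monoid)
qed (blast intro: hom_eq.sym hom_eq.trans)+

text \<open>Well-definedness of composition: the representative of the inner morphism is changed
  while the outer one is the class of \<open>u\<close>, then the outer one is changed. Composites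
  can thereafter be computed by concatenating words.\<close>

lemma hom_compose_class:
  assumes u: "u \<in> words l" and w: "w \<in> words m" and "n \<le> m" "m \<le> l"
  shows "hom_compose n l (hom_class m l (hecke_class l u)) (hom_class n m (hecke_class m w)) =
    hom_class n l (hecke_class l (u @ w))"
proof -
  have wl: "w \<in> words l" using w \<open>m \<le> l\<close> by (rule words_mono)
  have "hom_class n l (hecke_mult l y (hecke_incl l x)) = hom_class n l (hecke_class l (u @ w))"
    if y: "hom_eq m l (hecke_class l u) y" and x: "hom_eq n m (hecke_class m w) x" for x y
  proof -
    obtain w' where w': "w' \<in> words m" "x = hecke_class m w'"
      using hom_eq_monoid[OF x] by (auto simp: hecke_monoid_def)
    have "hom_eq n l (hecke_mult l (hecke_class l u) (hecke_incl l (hecke_class m w)))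
        (hecke_mult l (hecke_class l u) (hecke_incl l x))"
      by (rule hom_eq_mult_left[OF x u \<open>m \<le> l\<close>])
    moreover have "hom_eq n l (hecke_mult l (hecke_class l u) (hecke_incl l x))
        (hecke_mult l y (hecke_incl l x))"
      using hom_eq_mult_right[OF y w'(1) \<open>n \<le> m\<close> \<open>m \<le> l\<close>] w' \<open>m \<le> l\<close> by (simp add: hecke_incl_class)
    ultimately have "hom_eq n l (hecke_class l (u @ w)) (hecke_mult l y (hecke_incl l x))"
      using hom_eq.trans u w wl \<open>m \<le> l\<close> by (fastforce simp: hecke_incl_class hecke_mult_class)
    then show ?thesis
      using u wl hom_class_eq_iff[OF hecke_class_monoid, of "u @ w" l n] by (metis words_append)
  qed
  moreover have "hecke_class l u \<in> hom_class m l (hecke_class l u)"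
    "hecke_class m w \<in> hom_class n m (hecke_class m w)"
    using u w by (auto intro: hom_class_mem hecke_class_monoid)
  ultimately show ?thesis
    unfolding hom_compose_def by (fastforce simp: hom_class_def)
qed

lemma Hom_obtain_word:
  assumes "f \<in> Hom n m"
  obtains u where "n \<le> m" "u \<in> words m" "f = hom_class n m (hecke_class m u)"
  using assms by (auto simp: Hom_def hecke_monoid_def split: if_splits)

lemma hom_class_in_Hom: "n \<le> m \<Longrightarrow> u \<in> words m \<Longrightarrow> hom_class n m (hecke_class m u) \<in> Hom n m"
  by (simp add: Hom_def hecke_class_monoid)


section \<open>The functor\<close>

lemma HV_shape_Suc: "sum_list \<tau> \<le> m \<Longrightarrow> HV_shape \<tau> (Suc m) = HV_shape \<tau> m @ [Suc 0]"
  by (simp add: HV_shape_def Suc_diff_le replicate_append_same)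

lemma sum_list_HV_shape: "sum_list \<tau> \<le> m \<Longrightarrow> sum_list (HV_shape \<tau> m) = m"
  by (simp add: HV_shape_def sum_list_replicate)

fun Phi_iter :: "nat list \<Rightarrow> nat \<Rightarrow> nat \<Rightarrow> 'k::field vec \<Rightarrow> 'k vec" where
  "Phi_iter \<tau> n 0 v = v"
| "Phi_iter \<tau> n (Suc d) v = Phi (HV_shape \<tau> (n + d)) (Phi_iter \<tau> n d v)"

lemma Phi_iter_linear [simp]:
  "Phi_iter \<tau> n d 0 = 0"
  "Phi_iter \<tau> n d (v + w) = Phi_iter \<tau> n d v + Phi_iter \<tau> n d w"
  "Phi_iter \<tau> n d (vec_scale c v) = vec_scale c (Phi_iter \<tau> n d v)"
  by (induction d) simp_all

lemma Phi_iter_add: "Phi_iter \<tau> n (d + e) v = Phi_iter \<tau> (n + d) e (Phi_iter \<tau> n d v)"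
  by (induction e) (simp_all add: add.assoc)

lemma Phi_iter_closed:
  "sum_list \<tau> \<le> n \<Longrightarrow> v \<in> tableau_space (HV_shape \<tau> n) \<Longrightarrow>
    Phi_iter \<tau> n d v \<in> tableau_space (HV_shape \<tau> (n + d))"
  by (induction d) (auto simp: HV_shape_Suc intro: Phi_closed)

lemma word_action_Phi_iter:
  assumes "sum_list \<tau> \<le> n" "v \<in> tableau_space (HV_shape \<tau> n)" "u \<in> words n"
  shows "word_action (HV_shape \<tau> (n + d)) u (Phi_iter \<tau> n d v) =
    Phi_iter \<tau> n d (word_action (HV_shape \<tau> n) u v)"
proof (induction d)
  case (Suc d)
  have "u \<in> words (n + d)" using assms(3) by (rule words_mono) simp
  then show ?case
    using Suc assms by (simp add: HV_shape_Suc word_action_Phi Phi_iter_closed sum_list_HV_shape)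
qed simp

text \<open>The letter j acts on two adjoined entries. It fixes the vector as soon as both are
  present, and commutes with every later \<open>Phi\<close>.\<close>

lemma pi_action_Phi_iter:
  assumes "sum_list \<tau> \<le> n" "v \<in> tableau_space (HV_shape \<tau> n)" "j \<in> {n + 1..<n + d}"
  shows "pi_action (HV_shape \<tau> (n + d)) j (Phi_iter \<tau> n d v) = Phi_iter \<tau> n d v"
  using assms(3)
proof (induction d)
  case (Suc d)
  show ?case
  proof (cases "j = n + d")
    case True
    \<comment> \<open>Here j is the newest letter. Since j is at least n + 1, at least one box was
      adjoined before the last, so the entries j and j + 1 are the last two adjoined.\<close>
    then obtain e where e: "d = Suc e" using Suc.prems by (cases d) auto
    have "Phi_iter \<tau> n e v \<in> tableau_space (HV_shape \<tau> (n + e))"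
      using assms by (intro Phi_iter_closed)
    from pi_action_Phi_Phi[OF this] show ?thesis
      using assms(1) by (simp add: True e HV_shape_Suc sum_list_HV_shape)
  next
    case False
    then have "pi_action (HV_shape \<tau> (n + d)) j (Phi_iter \<tau> n d v) = Phi_iter \<tau> n d v"
      using Suc by simp
    moreover have "pi_action (HV_shape \<tau> (n + d) @ [Suc 0]) j (Phi (HV_shape \<tau> (n + d)) (Phi_iter \<tau> n d v)) =
        Phi (HV_shape \<tau> (n + d)) (pi_action (HV_shape \<tau> (n + d)) j (Phi_iter \<tau> n d v))"
      by (rule pi_action_Phi) (use False Suc.prems assms in \<open>auto simp: sum_list_HV_shape Phi_iter_closed\<close>)
    ultimately show ?thesis using assms(1) by (simp add: HV_shape_Suc)
  qed
qed simp

text \<open>A morphism is only a class, so a representing word is chosen. Below the sum of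
  \<open>\<tau>\<close> the space is zero, whence the default value.\<close>

definition HV_act :: "nat list \<Rightarrow> nat \<Rightarrow> nat \<Rightarrow> morphism \<Rightarrow> 'k::field vec \<Rightarrow> 'k vec" where
  "HV_act \<tau> n m f v =
     (if sum_list \<tau> \<le> n
      then word_action (HV_shape \<tau> m) (SOME u. u \<in> words m \<and> hom_class n m (hecke_class m u) = f)
        (Phi_iter \<tau> n (m - n) v)
      else 0)"

text \<open>Arbitrary members \<open>u\<close> and \<open>w\<close> of the two monoid elements are
  compared, so that one induction on \<open>hom_eq\<close> also absorbs the change of word inside a
  \<open>hecke_eq\<close> class.\<close>

lemma hom_eq_word_action:
  assumes "hom_eq n m x y" "sum_list \<tau> \<le> n" "n \<le> m" "v \<in> tableau_space (HV_shape \<tau> n)"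
    and "u \<in> x" "w \<in> y"
  shows "word_action (HV_shape \<tau> m) u (Phi_iter \<tau> n (m - n) v) =
    word_action (HV_shape \<tau> m) w (Phi_iter \<tau> n (m - n) v)"
proof -
  let ?v = "Phi_iter \<tau> n (m - n) v" and ?\<alpha> = "HV_shape \<tau> m"
  have v: "?v \<in> tableau_space ?\<alpha>"
    using Phi_iter_closed[OF assms(2,4), of "m - n"] assms(3) by simp
  have same: "word_action ?\<alpha> a ?v = word_action ?\<alpha> b ?v" if "a \<in> hecke_class m b" for a b
    using word_action_hecke_eq[of ?\<alpha> b a ?v] that v sum_list_HV_shape[of \<tau> m] assms(2,3)
    by (simp add: hecke_class_def)
  show ?thesis using assms(1,5,6)
  proof (induction arbitrary: u w rule: hom_eq.induct)
    case (drop x j)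
    then obtain u0 where u0: "u0 \<in> words m" "x = hecke_class m u0" by (auto simp: hecke_monoid_def)
    have "[j] \<in> words m" using drop(2) by (auto simp: words_def)
    then have "w \<in> hecke_class m (u0 @ [j])"
      using drop(4) u0 by (simp add: hecke_gen_def hecke_mult_class)
    then have "word_action ?\<alpha> w ?v = word_action ?\<alpha> u0 (pi_action ?\<alpha> j ?v)"
      using same by (simp add: word_action_append)
    also have "pi_action ?\<alpha> j ?v = ?v"
      using pi_action_Phi_iter[OF assms(2,4), of j "m - n"] drop(2) assms(3) by simp
    finally show ?case using same[of u u0] drop(3) u0 by simp
  next
    case (refl x)
    then obtain b where "x = hecke_class m b" by (auto simp: hecke_monoid_def)
    then show ?case using same[of u b] same[of w b] refl(2,3) by simp
  next
    case (trans x y z)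
    \<comment> \<open>The two induction hypotheses need a word in the middle element; monoid
      elements are nonempty.\<close>
    have "y \<in> hecke_monoid m" using hom_eq_monoid[OF trans.hyps(1)] ..
    then obtain a where "a \<in> y" using hecke_class_mem by (auto simp: hecke_monoid_def)
    then show ?case using trans.IH(1)[OF trans.prems(1)] trans.IH(2)[OF _ trans.prems(2)] by simp
  qed simp
qed

lemma HV_act_class:
  assumes "sum_list \<tau> \<le> n" "n \<le> m" "v \<in> tableau_space (HV_shape \<tau> n)" "u \<in> words m"
  shows "HV_act \<tau> n m (hom_class n m (hecke_class m u)) v =
    word_action (HV_shape \<tau> m) u (Phi_iter \<tau> n (m - n) v)"
proof -
  let ?P = "\<lambda>w. w \<in> words m \<and> hom_class n m (hecke_class m w) = hom_class n m (hecke_class m u)"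
  have w: "?P (SOME w. ?P w)" by (rule someI[of ?P u]) (use assms(4) in simp)
  then have "hom_eq n m (hecke_class m (SOME w. ?P w)) (hecke_class m u)"
    using hom_class_eq_iff[OF hecke_class_monoid] by blast
  then show ?thesis
    using hom_eq_word_action[OF _ assms(1-3)] hecke_class_mem w assms(1,4) by (simp add: HV_act_def)
qed

lemma HV_space_eq: "sum_list \<tau> \<le> n \<Longrightarrow> HV_space \<tau> n = tableau_space (HV_shape \<tau> n)"
  by (simp add: HV_space_def)

lemma HV_act_compose:
  assumes f: "f \<in> Hom n m" and g: "g \<in> Hom m l" and v: "v \<in> HV_space \<tau> n"
  shows "HV_act \<tau> n l (hom_compose n l g f) v = HV_act \<tau> m l g (HV_act \<tau> n m f v)"
proof (cases "sum_list \<tau> \<le> n")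
  case True
  obtain w where w: "n \<le> m" "w \<in> words m" "f = hom_class n m (hecke_class m w)"
    using f by (rule Hom_obtain_word)
  obtain u where u: "m \<le> l" "u \<in> words l" "g = hom_class m l (hecke_class l u)"
    using g by (rule Hom_obtain_word)
  have v': "v \<in> tableau_space (HV_shape \<tau> n)" using v True by (simp add: HV_space_eq)
  have wl: "w \<in> words l" using w(2) u(1) by (rule words_mono)
  let ?v = "Phi_iter \<tau> n (m - n) v"
  have c: "?v \<in> tableau_space (HV_shape \<tau> m)"
    using Phi_iter_closed[OF True v', of "m - n"] w(1) by simp
  have "HV_act \<tau> n l (hom_compose n l g f) v =
      word_action (HV_shape \<tau> l) u (word_action (HV_shape \<tau> l) w (Phi_iter \<tau> n (l - n) v))"
    using HV_act_class[OF True _ v', of l "u @ w"] u w wl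
    by (simp add: hom_compose_class words_append word_action_append)
  also have "Phi_iter \<tau> n (l - n) v = Phi_iter \<tau> m (l - m) ?v"
    using Phi_iter_add[of \<tau> n "m - n" "l - m" v] w(1) u(1) by simp
  \<comment> \<open>The inner word has letters below m only, so it can be moved past the boxes
    adjoined between m and l.\<close>
  also have "word_action (HV_shape \<tau> l) w (Phi_iter \<tau> m (l - m) ?v) =
      Phi_iter \<tau> m (l - m) (word_action (HV_shape \<tau> m) w ?v)"
    using word_action_Phi_iter[OF _ c w(2), of "l - m"] w(1) u(1) True by simp
  also have "word_action (HV_shape \<tau> m) w ?v = HV_act \<tau> n m f v"
    using HV_act_class[OF True w(1) v' w(2)] w(3) by simp
  also have "word_action (HV_shape \<tau> l) u (Phi_iter \<tau> m (l - m) (HV_act \<tau> n m f v)) =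
      HV_act \<tau> m l g (HV_act \<tau> n m f v)"
    using HV_act_class[OF _ u(1) _ u(2), of \<tau> "HV_act \<tau> n m f v"] u(3) True w(1)
      word_action_closed[OF c, of w] HV_act_class[OF True w(1) v' w(2)] w(3) by simp
  finally show ?thesis .
qed (simp add: HV_act_def)

lemma HV_act_closed:
  assumes "f \<in> Hom n m" "v \<in> HV_space \<tau> n"
  shows "HV_act \<tau> n m f v \<in> HV_space \<tau> m"
proof (cases "sum_list \<tau> \<le> n")
  case True
  have "n \<le> m" using assms(1) by (rule Hom_obtain_word)
  then have "Phi_iter \<tau> n (m - n) v \<in> tableau_space (HV_shape \<tau> m)"
    using Phi_iter_closed[OF True, of v "m - n"] assms(2) True by (simp add: HV_space_eq)
  then show ?thesis
    using True \<open>n \<le> m\<close> by (simp add: HV_act_def HV_space_eq word_action_closed)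
qed (simp add: HV_act_def HV_space_def)

lemma HV_act_generators:
  assumes "sum_list \<tau> \<le> n" "v \<in> HV_space \<tau> n"
  shows "HV_act \<tau> n n (iota n n) v = v"
    and "j \<in> {1..<n} \<Longrightarrow> HV_act \<tau> n n (end_gen n j) v = pi_action (HV_shape \<tau> n) j v"
    and "HV_act \<tau> n (Suc n) (iota n (Suc n)) v = Phi (HV_shape \<tau> n) v"
  using assms HV_act_class[of \<tau> n n v "[]"] HV_act_class[of \<tau> n n v "[j]"]
    HV_act_class[of \<tau> n "Suc n" v "[]"]
  by (simp_all add: HV_space_eq iota_def end_gen_def hecke_one_def hecke_gen_def words_def)

lemma H_module_HV: "H_module vec_scale (HV_space \<tau>) (HV_act \<tau> :: _ \<Rightarrow> _ \<Rightarrow> _ \<Rightarrow> 'k::field vec \<Rightarrow> _)"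
proof (intro H_module.intro H_module_axioms.intro)
  show "vec.subspace (HV_space \<tau> n :: 'k vec set)" for n
    by (auto simp: HV_space_def subspace_tableau_space)
  show "HV_act \<tau> n n (iota n n) v = v" if "v \<in> HV_space \<tau> n" for n and v :: "'k vec"
    using that HV_act_generators(1)[of \<tau> n v]
    by (cases "sum_list \<tau> \<le> n") (simp_all add: HV_act_def HV_space_def)
qed (auto simp: HV_act_closed HV_act_compose vec.vector_space_axioms, auto simp: HV_act_def)

section \<open>Existence of the module and its finite generation\<close>

theorem proposition13p10:
  fixes n :: nat and \<tau> :: "nat list"
  assumes "composition n \<tau>"
  shows "(\<exists>act :: nat \<Rightarrow> nat \<Rightarrow> morphism \<Rightarrow> 'k::field vec \<Rightarrow> 'k vec. is_HV \<tau> act) \<and>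
         (\<forall>act :: nat \<Rightarrow> nat \<Rightarrow> morphism \<Rightarrow> 'k vec \<Rightarrow> 'k vec. is_HV \<tau> act \<longrightarrow>
            H_module.finitely_generated vec_scale (HV_space \<tau>) act)"
proof (intro conjI allI impI)
  show "\<exists>act :: nat \<Rightarrow> nat \<Rightarrow> morphism \<Rightarrow> 'k vec \<Rightarrow> 'k vec. is_HV \<tau> act"
    by (rule exI[of _ "HV_act \<tau>"]) (simp add: is_HV_def H_module_HV HV_act_generators)
next
  fix act :: "nat \<Rightarrow> nat \<Rightarrow> morphism \<Rightarrow> 'k vec \<Rightarrow> 'k vec"
  assume HV: "is_HV \<tau> act"
  then interpret H_module vec_scale "HV_space \<tau>" act by (simp add: is_HV_def)
  let ?N = "sum_list \<tau>" and ?B = "(\<lambda>T. Poly_Mapping.single T (1::'k)) ` SRCT \<tau>"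
  \<comment> \<open>At this object no rows of length 1 are appended, so the shape is
    \<open>\<tau>\<close> itself.\<close>
  have top: "HV_space \<tau> ?N = vec.span ?B"
    by (simp add: HV_space_eq HV_shape_def tableau_space_eq_span)
  have "W = HV_space \<tau>" if W: "submodule W" "{?N} \<times> ?B \<subseteq> Sigma UNIV W" for W
  proof
    fix m
    have sub: "vec.subspace (W i)" "W i \<subseteq> HV_space \<tau> i" for i
      using W(1) by (auto simp: submodule_def)
    have "HV_space \<tau> m \<subseteq> W m"
    proof (cases "?N \<le> m")
      case True
      then show ?thesis
      proof (induction m rule: dec_induct)
        case base
        have "?B \<subseteq> W ?N" using W(2) by auto
        then show ?case unfolding top using sub(1) by (rule vec.span_minimal)
      next
        case (step i)
        show ?case
        proof
          fix v :: "'k vec" assume "v \<in> HV_space \<tau> (Suc i)"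
          then obtain w where w: "w \<in> HV_space \<tau> i" "v = Phi (HV_shape \<tau> i) w"
            \<comment> \<open>By surjectivity of \<open>Phi\<close>, a vector of the next space is
              the image under \<open>iota\<close> of one that already lies in
              \<open>W\<close>.\<close>
            using Phi_surj[of v "HV_shape \<tau> i"] step(1) by (auto simp: HV_space_eq HV_shape_Suc)
          have "iota i (Suc i) \<in> Hom i (Suc i)"
            by (simp add: iota_def hecke_one_def hom_class_in_Hom words_def)
          moreover have "w \<in> W i" using w(1) step.IH by blast
          ultimately have "act i (Suc i) (iota i (Suc i)) w \<in> W (Suc i)"
            using W(1) unfolding submodule_def by blast
          then show "v \<in> W (Suc i)"
            using HV w step(1) by (simp add: is_HV_def)
        qed
      qed
    next
      case False
      then show ?thesis using vec.subspace_0[OF sub(1)] by (simp add: HV_space_def)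
    qed
    then show "W m = HV_space \<tau> m" using sub(2) by blast
  qed
  moreover have "{?N} \<times> ?B \<subseteq> Sigma UNIV (HV_space \<tau>)"
    using vec.span_superset[of ?B] by (auto simp: top)
  moreover have "finite ({?N} \<times> ?B)" by (simp add: finite_SRCT)
  ultimately show "finitely_generated" unfolding finitely_generated_def by blast
qed

end
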